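(* Let $\mathbb X,\mathbb Y$ be Polish spaces, $(\Omega,\mathscr F,P)$ a probability space, $\mu$ a probability kernel from $\Omega$ to $\mathbb X$ and $\nu$ a probability kernel from $\Omega$ to $\mathbb Y$. Let $c:\Omega\times\mathbb X\times\mathbb Y\to[0,\infty]$ be a measurable function such that for each $\omega\in\Omega$, $(x,y)\mapsto c(\omega,x,y)$ is continuous, and for each $(x,y)\in\mathbb X\times\mathbb Y$, $\omega\mapsto c(\omega,x,y)$ is $\mathscr F$-measurable, and such that $$\mathbb E\int_{\mathbb X\times\mathbb Y}c(\omega,x,y)\,\mu_\omega(dx)\,\nu_\omega(dy)<+\infty .$$ Then there exists $\pi^{\mathrm{opt}}\in\mathcal K(\mu,\nu)$ (a stochastic optimal transference plan) such that $$C^{\mathrm{stoch}}(c,\mu,\nu)=\mathbb E\int_{\mathbb X\times\mathbb Y}c(\omega,x,y)\,\pi^{\mathrm{opt}}_\omega(dx,dy)<+\infty .$$ Moreover, $\omega\mapsto C^{\mathrm{deter}}(c(\omega),\mu_\omega,\nu_\omega)$ is $\mathscr F$-measurable and $$C^{\mathrm{stoch}}(c,\mu,\nu)=\mathbb E\left(\inf_{\pi\in\Pi(\mu_\omega,\nu_\omega)}\int_{\mathbb X\times\mathbb Y}c(\omega,x,y)\,\pi(dx,dy)\right)=\mathbb E\Big(C^{\mathrm{deter}}(c(\omega),\mu_\omega,\nu_\omega)\Big).$$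
   Context: For a Polish space $\mathbb X$, $\mathscr B(\mathbb X)$ is its Borel $\sigma$-field and $\mathcal P(\mathbb X)$ is the set of Borel probability measures on $\mathbb X$. A probability kernel $\mu$ from $\Omega$ to $\mathbb X$ is a map $\mu:\Omega\times\mathscr B(\mathbb X)\to[0,1]$ such that $\mu_\omega\in\mathcal P(\mathbb X)$ for each $\omega\in\Omega$ and $\omega\mapsto\mu_\omega(B)$ is $\mathscr F$-measurable for each $B\in\mathscr B(\mathbb X)$. $\mathbb E$ is expectation with respect to $P$ (in the variable $\omega$). For $\mu_0\in\mathcal P(\mathbb X)$, $\nu_0\in\mathcal P(\mathbb Y)$, $\Pi(\mu_0,\nu_0)$ is the set of probability measures on $\mathbb X\times\mathbb Y$ with marginals $\mu_0$ and $\nu_0$, and for a cost function $c_0:\mathbb X\times\mathbb Y\to[0,\infty]$, $$C^{\mathrm{deter}}(c_0,\mu_0,\nu_0):=\inf_{\pi\in\Pi(\mu_0,\nu_0)}\int_{\mathbb X\times\mathbb Y}c_0(x,y)\,\pi(dx,dy).$$ $c(\omega)$ denotes the function $(x,y)\mapsto c(\omega,x,y)$. For kernels $\mu,\nu$, $\mathcal K(\mu,\nu)$ is the set of all probability kernels $\pi$ from $\Omega$ to $\mathbb X\times\mathbb Y$ with $\pi_\omega(\cdot\times\mathbb Y)=\mu_\omega$ and $\pi_\omega(\mathbb X\times\cdot)=\nu_\omega$ for all $\omega$, and $$C^{\mathrm{stoch}}(c,\mu,\nu):=\inf_{\pi\in\mathcal K(\mu,\nu)}\mathbb E\int_{\mathbb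 X\times\mathbb Y}c(\omega,x,y)\,\pi_\omega(dx,dy).$$ A stochastic optimal transference plan is an element of $\mathcal K(\mu,\nu)$ attaining this infimum. *)

theory Defs
  imports "HOL-Probability.Probability"
begin

text \<open>Probability kernels are measurable maps into the Giry space
  \<^const>\<open>prob_algebra\<close> of probability measures. On a second countable product the measure
  \<^term>\<open>borel\<close> is the product of the two factors (\<open>borel_prod\<close>).\<close>

definition prob_kernel :: "'w measure \<Rightarrow> ('w \<Rightarrow> 'a::topological_space measure) \<Rightarrow> bool" where
  "prob_kernel M \<mu> \<longleftrightarrow> \<mu> \<in> M \<rightarrow>\<^sub>M prob_algebra borel"

lemma prob_kernel_iff:
  "prob_kernel M \<mu> \<longleftrightarrow>
     (\<forall>\<omega>\<in>space M. prob_space (\<mu> \<omega>) \<and> sets (\<mu> \<omega>) = sets borel) \<and>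
     (\<forall>B\<in>sets borel. (\<lambda>\<omega>. emeasure (\<mu> \<omega>) B) \<in> borel_measurable M)"
proof
  assume "prob_kernel M \<mu>"
  hence \<mu>: "\<mu> \<in> M \<rightarrow>\<^sub>M prob_algebra borel" by (simp add: prob_kernel_def)
  have "\<mu> \<in> M \<rightarrow>\<^sub>M subprob_algebra borel" by (rule measurable_prob_algebraD[OF \<mu>])
  moreover have "\<mu> \<omega> \<in> space (prob_algebra borel)" if "\<omega> \<in> space M" for \<omega>
    using measurable_space[OF \<mu> that] .
  ultimately show "(\<forall>\<omega>\<in>space M. prob_space (\<mu> \<omega>) \<and> sets (\<mu> \<omega>) = sets borel) \<and>
     (\<forall>B\<in>sets borel. (\<lambda>\<omega>. emeasure (\<mu> \<omega>) B) \<in> borel_measurable M)"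
    by (auto simp: space_prob_algebra intro: measurable_emeasure_kernel)
next
  assume *: "(\<forall>\<omega>\<in>space M. prob_space (\<mu> \<omega>) \<and> sets (\<mu> \<omega>) = sets borel) \<and>
     (\<forall>B\<in>sets borel. (\<lambda>\<omega>. emeasure (\<mu> \<omega>) B) \<in> borel_measurable M)"
  hence "\<mu> \<in> M \<rightarrow>\<^sub>M subprob_algebra borel"
    by (intro measurable_subprob_algebra) (auto intro: prob_space_imp_subprob_space)
  with * show "prob_kernel M \<mu>"
    unfolding prob_kernel_def by (intro measurable_prob_algebraI) auto
qed

definition couplings ::
  "'a::topological_space measure \<Rightarrow> 'b::topological_space measure \<Rightarrow> ('a \<times> 'b) measure set" where
  "couplings \<mu>0 \<nu>0 =
     {\<pi>. prob_space \<pi> \<and> sets \<pi> = sets borel \<and> distr \<pi> borel fst = \<mu>0 \<and> distr \<pi> borel snd = \<nu>0}"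

definition C_deter ::
  "('a::topological_space \<Rightarrow> 'b::topological_space \<Rightarrow> ennreal) \<Rightarrow> 'a measure \<Rightarrow> 'b measure \<Rightarrow> ennreal" where
  "C_deter c0 \<mu>0 \<nu>0 = (INF \<pi>\<in>couplings \<mu>0 \<nu>0. \<integral>\<^sup>+ (x, y). c0 x y \<partial>\<pi>)"

definition kernel_couplings ::
  "'w measure \<Rightarrow> ('w \<Rightarrow> 'a::topological_space measure) \<Rightarrow> ('w \<Rightarrow> 'b::topological_space measure)
     \<Rightarrow> ('w \<Rightarrow> ('a \<times> 'b) measure) set" where
  "kernel_couplings M \<mu> \<nu> =
     {\<pi>. prob_kernel M \<pi> \<and>
       (\<forall>\<omega>\<in>space M. distr (\<pi> \<omega>) borel fst = \<mu> \<omega> \<and> distr (\<pi> \<omega>) borel snd = \<nu> \<omega>)}"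

definition C_stoch ::
  "'w measure \<Rightarrow> ('w \<Rightarrow> 'a::topological_space \<Rightarrow> 'b::topological_space \<Rightarrow> ennreal)
     \<Rightarrow> ('w \<Rightarrow> 'a measure) \<Rightarrow> ('w \<Rightarrow> 'b measure) \<Rightarrow> ennreal" where
  "C_stoch M c \<mu> \<nu> =
     (INF \<pi>\<in>kernel_couplings M \<mu> \<nu>. \<integral>\<^sup>+ \<omega>. (\<integral>\<^sup>+ (x, y). c \<omega> x y \<partial>\<pi> \<omega>) \<partial>M)"

end

theory Submission
  imports Defs
begin

text \<open>
  A coupling of \<open>\<mu>\<^sub>\<omega>\<close> and \<open>\<nu>\<^sub>\<omega>\<close> is determined by its values on a countable algebra \<open>E\<^sub>0, E\<^sub>1, \<dots>\<close> of
  subsets of the product that generates the Borel sets, hence by a point \<open>m\<close> of the compact cube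
  \<open>[0,1]\<^sup>\<nat>\<close>. This changes the selection problem from one about measures, where the set of couplings
  moves with \<open>\<omega>\<close>, into one about a moving closed subset of a fixed compact metric space.

  Which points \<open>m\<close> come from a coupling of cost at most \<open>s\<close>? Finite additivity on the algebra and
  correct values on the cylinders are necessary. They are also sufficient: inner regularity and
  tightness of the two marginals pass to the finitely additive set function, so it is continuous at
  the empty set and the Caratheodory extension applies
  (\<open>coupling_of_coupling_values\<close>). The algebra is built from basic open sets and their closures
  precisely so that this approximation by closed sets takes place inside the algebra. As to the
  cost, a continuous \<open>c\<close> is a supremum of step functions over the algebra, so the
  condition that the cost is at most \<open>s\<close> amounts to countably many linear inequalities in \<open>m\<close>
  (\<open>nn_integral_le_of_steps\<close>). All conditions are closed, whence the minimum is attained, and each of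
  them depends measurably on \<open>\<omega>\<close>.

  For a countable system of inequalities that are continuous in \<open>m\<close> and measurable in \<open>\<omega>\<close>, solvability in
  a compact set is a measurable event, because compactness replaces it by approximate solvability of
  finite subsystems, which can be tested on a countable dense set
  (\<open>sets_Collect_ex_compact\<close>). Applied with cost bound \<open>s\<close>, this gives measurability of the
  optimal value. Applied with the optimal value itself as the bound, it shows that the compact set of
  optimal value sequences hits every closed set measurably. Minimising the coordinates of \<open>m\<close> one
  after the other within that set then picks a measurable optimal \<open>m\<close>
  (\<open>hit_measurable_selection\<close>). The corresponding couplings form a kernel, since
  measurability of a kernel may be checked on a generating algebra; being optimal for
  each \<open>\<omega>\<close>, the kernel is optimal after integration.
\<close>

section \<open>Measurable selection from compact sets\<close>

lemma countable_dense_subset: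
  fixes S :: "'z::second_countable_topology set"
  obtains D where "countable D" "D \<subseteq> S" "S \<subseteq> closure D"
proof -
  obtain B :: "'z set set" where B: "countable B" "topological_basis B"
    using ex_countable_basis by auto
  define D where "D = (\<lambda>b. SOME x. x \<in> b \<inter> S) ` {b\<in>B. b \<inter> S \<noteq> {}}"
  have some: "(SOME x. x \<in> b \<inter> S) \<in> b \<inter> S" if "b \<inter> S \<noteq> {}" for b
    using that by (metis all_not_in_conv someI_ex)
  have "S \<subseteq> closure D"
  proof
    fix x assume "x \<in> S"
    show "x \<in> closure D"
      unfolding closure_iff_nhds_not_empty
    proof safe
      fix A V assume V: "V \<subseteq> A" "open V" "x \<in> V" and e: "D \<inter> A = {}"
      obtain b where "b \<in> B" "x \<in> b" "b \<subseteq> V"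
        using topological_basisE[OF B(2) V(2,3)] by blast
      with some[of b] \<open>x \<in> S\<close> have "(SOME x. x \<in> b \<inter> S) \<in> D \<inter> A"
        using V by (auto simp: D_def)
      with e show False by auto
    qed
  qed
  moreover have "countable D" "D \<subseteq> S"
    using B some by (auto simp: D_def)
  ultimately show ?thesis using that by blast
qed

text \<open>The sets of \<open>1 / Suc n\<close>-approximate solutions of the inequalities with code at most \<open>n\<close> are closed
  and decreasing in \<open>n\<close>, and their intersection consists of the exact solutions.\<close>

lemma compact_satisfies_all:
  fixes g :: "'i::countable \<Rightarrow> 'z::metric_space \<Rightarrow> real"
  assumes Z: "compact Z" and g: "\<And>j. continuous_on Z (g j)"
    and approx: "\<And>n. \<exists>z\<in>Z. \<forall>j. to_nat j \<le> n \<longrightarrow> g j z \<le> 1 / Suc n"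
  shows "\<exists>z\<in>Z. \<forall>j. g j z \<le> 0"
proof -
  define F where "F n = {z\<in>Z. \<forall>j. to_nat j \<le> n \<longrightarrow> g j z \<le> 1 / Suc n}" for n
  have F_eq: "F n = Z \<inter> (\<Inter>j\<in>{j. to_nat j \<le> n}. {z\<in>Z. g j z \<le> 1 / Suc n})" for n
    by (auto simp: F_def)
  have closed_le: "closed {z\<in>Z. g j z \<le> a}" for j a
  proof -
    have "{z\<in>Z. g j z \<le> a} = Z \<inter> g j -` {..a}" by auto
    then show ?thesis
      using continuous_on_closed_vimage[OF compact_imp_closed[OF Z]] g[of j]
      by (metis closed_atMost inf_commute)
  qed
  have closed_F: "closed (F n)" for n
    unfolding F_eq
    by (intro closed_Int closed_INT ballI compact_imp_closed[OF Z] closed_le)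
  have F_anti: "F n \<subseteq> F k" if "k \<le> n" for k n
  proof -
    have "1 / Suc n \<le> 1 / Suc k" using that by (intro divide_left_mono) auto
    then show ?thesis using that unfolding F_def by (fastforce intro: order_trans)
  qed
  have "Z \<inter> (\<Inter>n\<in>I. F n) \<noteq> {}" if "finite I" for I
  proof (cases "I = {}")
    case True
    then show ?thesis using approx[of 0] by auto
  next
    case False
    with that F_anti have "F (Max I) \<subseteq> (\<Inter>n\<in>I. F n)" by (intro INT_greatest) (simp add: that)
    moreover have "F (Max I) \<noteq> {}" using approx[of "Max I"] by (auto simp: F_def)
    ultimately show ?thesis by (auto simp: F_def)
  qed
  with closed_F have "Z \<inter> (\<Inter>n\<in>UNIV. F n) \<noteq> {}"
    by (rule compact_imp_fip_image[OF Z])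
  then obtain z where z: "z \<in> Z" "\<And>n. z \<in> F n" by auto
  have "g j z \<le> 0" for j
  proof (rule ccontr)
    assume "\<not> g j z \<le> 0"
    then obtain k where k: "1 / Suc k < g j z"
      using nat_approx_posE[of "g j z"] by (metis not_le)
    have "g j z \<le> 1 / Suc (max k (to_nat j))"
      using z(2)[of "max k (to_nat j)"] by (auto simp: F_def)
    also have "\<dots> \<le> 1 / Suc k" by (intro divide_left_mono) auto
    finally show False using k by simp
  qed
  with z show ?thesis by auto
qed

text \<open>The strict inequalities on the right-hand side of the equivalence below define a relatively open set of \<open>z\<close>, so a
  solution in \<open>Z\<close> can be moved into a countable dense subset. This turns the uncountable
  union over \<open>Z\<close> into a countable one, and avoids projection theorems, which would need a complete \<open>\<sigma>\<close>-algebra.\<close>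

lemma sets_Collect_ex_compact:
  fixes g :: "'i::countable \<Rightarrow> 'w \<Rightarrow> 'z::{metric_space, second_countable_topology} \<Rightarrow> real"
  assumes Z: "compact Z"
    and cont: "\<And>j \<omega>. \<omega> \<in> space M \<Longrightarrow> continuous_on Z (g j \<omega>)"
    and meas[measurable]: "\<And>j z. z \<in> Z \<Longrightarrow> (\<lambda>\<omega>. g j \<omega> z) \<in> borel_measurable M"
  shows "{\<omega>\<in>space M. \<exists>z\<in>Z. \<forall>j. g j \<omega> z \<le> 0} \<in> sets M"
proof -
  obtain D where D: "countable D" "D \<subseteq> Z" "Z \<subseteq> closure D"
    using countable_dense_subset[of Z] by blast
  have "(\<exists>z\<in>Z. \<forall>j. g j \<omega> z \<le> 0) \<longleftrightarrow> (\<forall>n. \<exists>z\<in>D. \<forall>j. to_nat j \<le> n \<longrightarrow> g j \<omega> z < 1 / Suc n)" (is "?L \<longleftrightarrow> ?R")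
    if \<omega>: "\<omega> \<in> space M" for \<omega>
  proof
    assume ?L
    then obtain z where z: "z \<in> Z" "\<And>j. g j \<omega> z \<le> 0" by auto
    show ?R
    proof
      fix n
      let ?J = "{j::'i. to_nat j \<le> n}"
      have fin: "finite ?J"
        using finite_vimageI[of "{..n}" "to_nat :: 'i \<Rightarrow> nat"] by (simp add: vimage_def)
      obtain s where s: "\<And>k. s k \<in> D" "s \<longlonglongrightarrow> z"
        using D(3) z(1) closure_sequential[of z D] by auto
      have "\<forall>\<^sub>F k in sequentially. g j \<omega> (s k) < 1 / Suc n" for j
      proof -
        have "(\<lambda>k. g j \<omega> (s k)) \<longlonglongrightarrow> g j \<omega> z"
          by (rule continuous_on_tendsto_compose[OF cont[OF \<omega>] s(2) z(1)]) (use s D in \<open>auto simp: subset_iff\<close>)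
        moreover have "g j \<omega> z < 1 / Suc n"
          by (rule le_less_trans[OF z(2)]) simp
        ultimately show ?thesis by (rule order_tendstoD)
      qed
      then have "\<forall>\<^sub>F k in sequentially. \<forall>j\<in>?J. g j \<omega> (s k) < 1 / Suc n"
        by (intro eventually_ball_finite[OF fin] ballI)
      then obtain k where "\<forall>j\<in>?J. g j \<omega> (s k) < 1 / Suc n"
        by (auto simp: eventually_sequentially)
      with s(1) show "\<exists>z\<in>D. \<forall>j. to_nat j \<le> n \<longrightarrow> g j \<omega> z < 1 / Suc n" by auto
    qed
  next
    assume R: ?R
    show ?L
    proof (rule compact_satisfies_all[OF Z cont[OF \<omega>]])
      show "\<exists>z\<in>Z. \<forall>j. to_nat j \<le> n \<longrightarrow> g j \<omega> z \<le> 1 / Suc n" for n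
        using R D(2) by (meson less_imp_le subsetD)
    qed
  qed
  then have "{\<omega>\<in>space M. \<exists>z\<in>Z. \<forall>j. g j \<omega> z \<le> 0} =
      {\<omega>\<in>space M. \<forall>n. \<exists>z\<in>D. \<forall>j. to_nat j \<le> n \<longrightarrow> g j \<omega> z < 1 / Suc n}" by blast
  also have "\<dots> \<in> sets M"
    using D by (intro sets.sets_Collect_countable_All sets.sets_Collect_countable_Ex'
        sets.sets_Collect_imp sets.sets_Collect_const borel_measurable_less) auto
  finally show ?thesis .
qed

text \<open>Weak measurability of a compact-valued multifunction is usually tested on open sets; closed test
  sets give the stronger notion, and they are what minimisation below produces.\<close>

definition hit_measurable :: "'w measure \<Rightarrow> ('w \<Rightarrow> 'z::metric_space set) \<Rightarrow> bool" where
  "hit_measurable M K \<longleftrightarrow>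
     (\<forall>\<omega>\<in>space M. compact (K \<omega>) \<and> K \<omega> \<noteq> {}) \<and>
     (\<forall>C. closed C \<longrightarrow> {\<omega>\<in>space M. K \<omega> \<inter> C \<noteq> {}} \<in> sets M)"

text \<open>Sublevel sets of the minimum are hitting events of closed sets, so the minimum is measurable.
  For the minimisers, the condition \<open>\<phi> z = u \<omega>\<close> has a bound that moves with \<open>\<omega>\<close>; by
  compactness it is the limit of the conditions \<open>\<phi> z \<le> q\<close> with rational \<open>q\<close> close to \<open>u \<omega>\<close>.\<close>

lemma hit_measurable_argmin:
  fixes \<phi> :: "'z::metric_space \<Rightarrow> real"
  assumes K: "hit_measurable M K" and \<phi>: "continuous_on UNIV \<phi>"
  obtains u where "u \<in> borel_measurable M" "hit_measurable M (\<lambda>\<omega>. {z\<in>K \<omega>. \<phi> z = u \<omega>})"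
proof -
  have comp: "compact (K \<omega>)" "K \<omega> \<noteq> {}" if "\<omega> \<in> space M" for \<omega>
    using K that by (auto simp: hit_measurable_def)
  have hit: "{\<omega>\<in>space M. K \<omega> \<inter> C \<noteq> {}} \<in> sets M" if "closed C" for C
    using K that by (auto simp: hit_measurable_def)
  define u where "u \<omega> = Inf (\<phi> ` K \<omega>)" for \<omega>
  have u: "\<exists>z\<in>K \<omega>. \<phi> z = u \<omega>" "\<And>z. z \<in> K \<omega> \<Longrightarrow> u \<omega> \<le> \<phi> z" if \<omega>: "\<omega> \<in> space M" for \<omega>
  proof -
    obtain z where z: "z \<in> K \<omega>" "\<And>y. y \<in> K \<omega> \<Longrightarrow> \<phi> z \<le> \<phi> y"
      using continuous_attains_inf[OF comp[OF \<omega>]] continuous_on_subset[OF \<phi>] by (metis subset_UNIV)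
    then have "u \<omega> = \<phi> z"
      unfolding u_def by (intro cInf_eq_minimum) auto
    with z show "\<exists>z\<in>K \<omega>. \<phi> z = u \<omega>" "\<And>z. z \<in> K \<omega> \<Longrightarrow> u \<omega> \<le> \<phi> z" by auto
  qed
  have cl: "closed {z. \<phi> z \<le> t}" for t
    using \<phi> by (intro closed_Collect_le) auto
  have u_meas[measurable]: "u \<in> borel_measurable M"
  proof (rule borel_measurableI_le)
    fix t
    have "{\<omega>\<in>space M. u \<omega> \<le> t} = {\<omega>\<in>space M. K \<omega> \<inter> {z. \<phi> z \<le> t} \<noteq> {}}"
      using u by (fastforce intro: order_trans)
    then show "{\<omega>\<in>space M. u \<omega> \<le> t} \<in> sets M" using hit[OF cl] by simp
  qed
  have "hit_measurable M (\<lambda>\<omega>. {z\<in>K \<omega>. \<phi> z = u \<omega>})"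
    unfolding hit_measurable_def
  proof (intro conjI ballI allI impI)
    fix \<omega> assume \<omega>: "\<omega> \<in> space M"
    have "{z\<in>K \<omega>. \<phi> z = u \<omega>} = K \<omega> \<inter> {z. \<phi> z = u \<omega>}" by auto
    also have "compact \<dots>"
      using \<phi> by (intro compact_Int_closed comp[OF \<omega>] closed_Collect_eq) auto
    finally show "compact {z\<in>K \<omega>. \<phi> z = u \<omega>}" .
    show "{z\<in>K \<omega>. \<phi> z = u \<omega>} \<noteq> {}" using u[OF \<omega>] by auto
  next
    fix C :: "'z set" assume C: "closed C"
    have eq: "{z\<in>K \<omega>. \<phi> z = u \<omega>} \<inter> C \<noteq> {} \<longleftrightarrow>
        (\<forall>n. \<exists>q::rat. of_rat q \<le> u \<omega> + 1 / Suc n \<and> K \<omega> \<inter> (C \<inter> {z. \<phi> z \<le> of_rat q}) \<noteq> {})"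
      (is "?L \<longleftrightarrow> ?R") if \<omega>: "\<omega> \<in> space M" for \<omega>
    proof
      assume ?L
      then obtain z where z: "z \<in> K \<omega>" "\<phi> z = u \<omega>" "z \<in> C" by auto
      show ?R
      proof
        fix n
        obtain q where "u \<omega> < of_rat q" "of_rat q < u \<omega> + 1 / Suc n"
          using of_rat_dense[of "u \<omega>" "u \<omega> + 1 / Suc n"] by auto
        with z show "\<exists>q::rat. of_rat q \<le> u \<omega> + 1 / Suc n \<and> K \<omega> \<inter> (C \<inter> {z. \<phi> z \<le> of_rat q}) \<noteq> {}"
          by (intro exI[of _ q]) auto
      qed
    next
      assume R: ?R
      have "\<exists>z\<in>K \<omega> \<inter> C. \<forall>j::unit. \<phi> z - u \<omega> \<le> 0"
      proof (rule compact_satisfies_all)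
        show "compact (K \<omega> \<inter> C)" using comp(1)[OF \<omega>] C by (rule compact_Int_closed)
        show "continuous_on (K \<omega> \<inter> C) (\<lambda>z. \<phi> z - u \<omega>)"
          using \<phi> by (intro continuous_intros) (auto intro: continuous_on_subset)
        fix n
        obtain q :: rat and z where "of_rat q \<le> u \<omega> + 1 / Suc n" "z \<in> K \<omega>" "z \<in> C" "\<phi> z \<le> of_rat q"
          using R by blast
        then show "\<exists>z\<in>K \<omega> \<inter> C. \<forall>j. to_nat j \<le> n \<longrightarrow> \<phi> z - u \<omega> \<le> 1 / Suc n"
          by (intro bexI[of _ z]) auto
      qed
      then show ?L using u[OF \<omega>] by (force intro: antisym)
    qed
    have "{\<omega>\<in>space M. {z\<in>K \<omega>. \<phi> z = u \<omega>} \<inter> C \<noteq> {}} =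
       {\<omega>\<in>space M. \<forall>n. \<exists>q::rat. of_rat q \<le> u \<omega> + 1 / Suc n \<and> K \<omega> \<inter> (C \<inter> {z. \<phi> z \<le> of_rat q}) \<noteq> {}}"
      using eq by (intro Collect_cong) blast
    also have "\<dots> \<in> sets M"
      by (intro sets.sets_Collect_countable_All sets.sets_Collect_countable_Ex sets.sets_Collect_conj
          hit closed_Int C cl) measurable
    finally show "{\<omega>\<in>space M. {z\<in>K \<omega>. \<phi> z = u \<omega>} \<inter> C \<noteq> {}} \<in> sets M" .
  qed
  with u_meas show ?thesis using that by blast
qed

text \<open>Lexicographic minimisation: minimise \<open>\<phi> 0\<close>, then \<open>\<phi> 1\<close> among the minimisers, and so on. The nested
  compact sets of minimisers have a common point \<open>s \<omega>\<close>, and \<open>\<phi> n (s \<omega>)\<close> is the \<open>n\<close>-th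
  minimum, so it is measurable by construction.\<close>

lemma hit_measurable_selection:
  fixes \<phi> :: "nat \<Rightarrow> 'z::metric_space \<Rightarrow> real"
  assumes K: "hit_measurable M K" and \<phi>: "\<And>n. continuous_on UNIV (\<phi> n)"
  obtains s where "\<And>\<omega>. \<omega> \<in> space M \<Longrightarrow> s \<omega> \<in> K \<omega>" "\<And>n. (\<lambda>\<omega>. \<phi> n (s \<omega>)) \<in> borel_measurable M"
proof -
  have "\<exists>L. \<forall>n::nat. (hit_measurable M (L n) \<and> (n = 0 \<longrightarrow> L n = K)) \<and>
      (\<exists>u. u \<in> borel_measurable M \<and> L (Suc n) = (\<lambda>\<omega>. {z\<in>L n \<omega>. \<phi> n z = u \<omega>}))"
  proof (rule dependent_nat_choice)
    show "\<exists>x. hit_measurable M x \<and> (0 = (0::nat) \<longrightarrow> x = K)" using K by auto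
    fix x and n :: nat assume "hit_measurable M x \<and> (n = 0 \<longrightarrow> x = K)"
    then have "hit_measurable M x" by simp
    from hit_measurable_argmin[OF this \<phi>[of n]] obtain u
      where u: "u \<in> borel_measurable M" "hit_measurable M (\<lambda>\<omega>. {z\<in>x \<omega>. \<phi> n z = u \<omega>})" .
    show "\<exists>y. (hit_measurable M y \<and> (Suc n = 0 \<longrightarrow> y = K)) \<and>
        (\<exists>u. u \<in> borel_measurable M \<and> y = (\<lambda>\<omega>. {z\<in>x \<omega>. \<phi> n z = u \<omega>}))"
      using u by (intro exI[of _ "\<lambda>\<omega>. {z\<in>x \<omega>. \<phi> n z = u \<omega>}"] conjI exI[of _ u]) simp_all
  qed
  then obtain L where *: "\<forall>n::nat. (hit_measurable M (L n) \<and> (n = 0 \<longrightarrow> L n = K)) \<and>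
      (\<exists>u. u \<in> borel_measurable M \<and> L (Suc n) = (\<lambda>\<omega>. {z\<in>L n \<omega>. \<phi> n z = u \<omega>}))" ..
  have L: "\<And>n. hit_measurable M (L n)" "L 0 = K" using * by simp_all
  have "\<forall>n. \<exists>u. u \<in> borel_measurable M \<and> L (Suc n) = (\<lambda>\<omega>. {z\<in>L n \<omega>. \<phi> n z = u \<omega>})"
    using * by simp
  from choice[OF this] obtain u where u: "\<And>n. u n \<in> borel_measurable M"
      "\<And>n. L (Suc n) = (\<lambda>\<omega>. {z\<in>L n \<omega>. \<phi> n z = u n \<omega>})"
    by auto
  have ex: "\<exists>z. \<forall>n. z \<in> L n \<omega>" if \<omega>: "\<omega> \<in> space M" for \<omega>
  proof -
    have comp: "compact (L n \<omega>)" "L n \<omega> \<noteq> {}" for n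
      using L(1)[of n] \<omega> by (auto simp: hit_measurable_def)
    have anti: "L n \<omega> \<subseteq> L k \<omega>" if "k \<le> n" for k n
      using that by (rule lift_Suc_antimono_le[of "\<lambda>n. L n \<omega>", rotated]) (auto simp: u(2))
    have "L 0 \<omega> \<inter> (\<Inter>n\<in>UNIV. L n \<omega>) \<noteq> {}"
    proof (rule compact_imp_fip_image)
      fix I :: "nat set" assume "finite I"
      then have "L (Max (insert 0 I)) \<omega> \<subseteq> L 0 \<omega> \<inter> (\<Inter>n\<in>I. L n \<omega>)"
        by (intro Int_greatest INT_greatest anti Max_ge) auto
      with comp(2) show "L 0 \<omega> \<inter> (\<Inter>n\<in>I. L n \<omega>) \<noteq> {}" by blast
    qed (auto intro: comp compact_imp_closed)
    then show ?thesis by blast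
  qed
  define s where "s \<omega> = (SOME z. \<forall>n. z \<in> L n \<omega>)" for \<omega>
  have s: "s \<omega> \<in> L n \<omega>" if "\<omega> \<in> space M" for \<omega> n
    using someI_ex[OF ex[OF that]] by (simp add: s_def)
  show ?thesis
  proof (rule that)
    show "s \<omega> \<in> K \<omega>" if "\<omega> \<in> space M" for \<omega> using s[OF that, of 0] L(2) by simp
    fix n
    have "\<phi> n (s \<omega>) = u n \<omega>" if "\<omega> \<in> space M" for \<omega>
      using s[OF that, of "Suc n"] by (simp add: u(2))
    then show "(\<lambda>\<omega>. \<phi> n (s \<omega>)) \<in> borel_measurable M"
      using u(1)[of n] measurable_cong[of M "\<lambda>\<omega>. \<phi> n (s \<omega>)" "u n"] by simp
  qed
qed

section \<open>Extending finitely additive set functions on complete metric spaces\<close>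

lemma totally_bounded_imp_compact_closure:
  fixes S :: "'z::complete_space set"
  assumes "\<And>d. d > 0 \<Longrightarrow> \<exists>k. finite k \<and> S \<subseteq> (\<Union>x\<in>k. ball x d)"
  shows "compact (closure S)"
  unfolding compact_eq_totally_bounded
proof (intro conjI allI impI)
  show "Topological_Spaces.complete (closure S)" by (simp add: complete_eq_closed)
  fix d :: real assume "d > 0"
  then obtain k where k: "finite k" "S \<subseteq> (\<Union>x\<in>k. ball x (d/2))" using assms[of "d/2"] by auto
  have "closure S \<subseteq> (\<Union>x\<in>k. cball x (d/2))"
    using k by (intro closure_minimal closed_UN) (force simp: subset_iff intro: less_imp_le)+
  also have "\<dots> \<subseteq> (\<Union>x\<in>k. ball x d)" using \<open>d > 0\<close> by (intro UN_mono) auto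
  finally show "\<exists>k. finite k \<and> closure S \<subseteq> (\<Union>x\<in>k. ball x d)" using k by blast
qed

locale additive_content = algebra UNIV R for R :: "'z set set" +
  fixes f :: "'z set \<Rightarrow> real"
  assumes nonneg: "A \<in> R \<Longrightarrow> 0 \<le> f A"
    and add: "A \<in> R \<Longrightarrow> B \<in> R \<Longrightarrow> A \<inter> B = {} \<Longrightarrow> f (A \<union> B) = f A + f B"
begin

lemma compl: "B \<in> R \<Longrightarrow> - B \<in> R"
  using compl_sets by (simp add: Compl_eq_Diff_UNIV)

lemma content_empty: "f {} = 0"
  using add[of "{}" "{}"] by auto

lemma content_mono:
  assumes "B \<in> R" "C \<in> R" "B \<subseteq> C"
  shows "f B \<le> f C"
proof -
  have "f C = f B + f (C - B)"
    using add[of B "C - B"] assms by (simp add: Un_absorb1 Diff)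
  then show ?thesis using nonneg[of "C - B"] assms by (simp add: Diff)
qed

lemma content_subadd: "B \<in> R \<Longrightarrow> C \<in> R \<Longrightarrow> f (B \<union> C) \<le> f B + f C"
  using add[of B "C - B"] content_mono[of "C - B" C] by (simp add: Diff)

lemma content_UN_le:
  fixes B :: "nat \<Rightarrow> 'z set"
  assumes "\<And>i. B i \<in> R"
  shows "(\<Union>i\<le>n. B i) \<in> R" "f (\<Union>i\<le>n. B i) \<le> (\<Sum>i\<le>n. f (B i))"
proof (induction n)
  case 0
  { case 1 show ?case using assms[of 0] by simp }
  { case 2 show ?case by simp }
next
  case (Suc n)
  have eq: "(\<Union>i\<le>Suc n. B i) = (\<Union>i\<le>n. B i) \<union> B (Suc n)"
    by (simp add: atMost_Suc Un_commute)
  { case 1 show ?case unfolding eq using Suc(1) assms by (intro Un) }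
  { case 2 show ?case unfolding eq
      using content_subadd[OF Suc(1) assms[of "Suc n"]] Suc(2) by simp }
qed

end

locale topological_content = additive_content R f
  for R :: "'z::complete_space set set" and f
begin

definition closed_regular :: "'z set \<Rightarrow> bool" where
  "closed_regular A \<longleftrightarrow> (\<forall>e>0. \<exists>F\<in>R. closed F \<and> F \<subseteq> A \<and> f (A - F) < e)"

definition tight :: bool where
  "tight \<longleftrightarrow> (\<forall>d>0. \<forall>e>0. \<exists>T\<in>R. f (- T) < e \<and> (\<exists>k. finite k \<and> T \<subseteq> (\<Union>x\<in>k. ball x d)))"

lemma closed_regular_Un:
  assumes AB: "A \<in> R" "B \<in> R" and reg: "closed_regular A" "closed_regular B"
  shows "closed_regular (A \<union> B)"
  unfolding closed_regular_def
proof (intro allI impI)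
  fix e :: real assume "e > 0"
  then obtain F G where F: "F \<in> R" "closed F" "F \<subseteq> A" "f (A - F) < e / 2"
    and G: "G \<in> R" "closed G" "G \<subseteq> B" "f (B - G) < e / 2"
    using reg unfolding closed_regular_def by (metis half_gt_zero)
  have "f ((A \<union> B) - (F \<union> G)) \<le> f ((A - F) \<union> (B - G))"
    using AB F G by (intro content_mono Un Diff) auto
  also have "\<dots> \<le> f (A - F) + f (B - G)" using AB F G by (intro content_subadd Diff)
  also have "\<dots> < e" using F G by simp
  finally show "\<exists>F\<in>R. closed F \<and> F \<subseteq> A \<union> B \<and> f (A \<union> B - F) < e"
    using F G by (intro bexI[of _ "F \<union> G"]) auto
qed

lemma closed_regular_Int:
  assumes AB: "A \<in> R" "B \<in> R" and reg: "closed_regular A" "closed_regular B"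
  shows "closed_regular (A \<inter> B)"
  unfolding closed_regular_def
proof (intro allI impI)
  fix e :: real assume "e > 0"
  then obtain F G where F: "F \<in> R" "closed F" "F \<subseteq> A" "f (A - F) < e / 2"
    and G: "G \<in> R" "closed G" "G \<subseteq> B" "f (B - G) < e / 2"
    using reg unfolding closed_regular_def by (metis half_gt_zero)
  have "f ((A \<inter> B) - (F \<inter> G)) \<le> f ((A - F) \<union> (B - G))"
    using AB F G by (intro content_mono Un Diff Int) auto
  also have "\<dots> \<le> f (A - F) + f (B - G)" using AB F G by (intro content_subadd Diff)
  also have "\<dots> < e" using F G by simp
  finally show "\<exists>F\<in>R. closed F \<and> F \<subseteq> A \<inter> B \<and> f (A \<inter> B - F) < e"
    using F G by (intro bexI[of _ "F \<inter> G"]) auto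
qed

text \<open>The classical argument for measures with a compact approximating class, carried out with closed
  and almost totally bounded sets: if \<open>A i\<close> decreases to the empty set, shrink each \<open>A i\<close> to a closed set
  \<open>F i\<close> and cut with a set \<open>T i\<close> covered by finitely many balls of radius \<open>1 / Suc i\<close>. If all
  finite intersections were inhabited, a sequence of witnesses would be totally bounded, and by
  completeness a cluster point would lie in every \<open>A i\<close>. Hence some finite intersection is empty, and
  \<open>A N\<close> is covered by the small remainders.\<close>

lemma empty_continuous:
  assumes inner: "\<And>A. A \<in> R \<Longrightarrow> closed_regular A" and tight: tight
    and A: "range A \<subseteq> R" "decseq A" "(\<Inter>i. A i) = {}"
  shows "(\<lambda>i. f (A i)) \<longlonglongrightarrow> 0"
proof (rule LIMSEQ_I)
  fix e :: real assume "e > 0"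
  \<comment> \<open>Two errors of size \<open>\<delta> i\<close> are made at each stage, and the total has to stay below \<open>e\<close>.\<close>
  define \<delta> where "\<delta> i = e / 2 ^ (i + 2)" for i
  have \<delta>: "\<delta> i > 0" for i using \<open>e > 0\<close> by (simp add: \<delta>_def)
  have "\<exists>F\<in>R. closed F \<and> F \<subseteq> A i \<and> f (A i - F) < \<delta> i" for i
  proof -
    have "closed_regular (A i)" using A(1) by (intro inner) (simp add: range_subsetD)
    then show ?thesis using \<delta>[of i] unfolding closed_regular_def by simp
  qed
  then obtain F where F: "\<And>i. F i \<in> R" "\<And>i. closed (F i)" "\<And>i. F i \<subseteq> A i" "\<And>i. f (A i - F i) < \<delta> i"
    by metis
  have "\<exists>T\<in>R. f (- T) < \<delta> i \<and> (\<exists>k. finite k \<and> T \<subseteq> (\<Union>x\<in>k. ball x (1 / Suc i)))" for i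
    using tight \<delta>[of i] unfolding tight_def by simp
  then obtain T where T: "\<And>i. T i \<in> R" "\<And>i. f (- T i) < \<delta> i"
      "\<And>i. \<exists>k. finite k \<and> T i \<subseteq> (\<Union>x\<in>k. ball x (1 / Suc i))"
    by metis
  have "\<exists>N. (\<Inter>i\<le>N. F i \<inter> T i) = {}"
  proof (rule ccontr)
    assume "\<not> ?thesis"
    then have "\<forall>N. \<exists>z. z \<in> (\<Inter>i\<le>N. F i \<inter> T i)" by blast
    from choice[OF this] obtain z where z: "\<And>N i. i \<le> N \<Longrightarrow> z N \<in> F i \<inter> T i" by blast
    have "compact (closure (range z))"
    proof (rule totally_bounded_imp_compact_closure)
      fix d :: real assume d: "d > 0"
      obtain i where i: "1 / Suc i < d" using nat_approx_posE[OF d] .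
      obtain k where k: "finite k" "T i \<subseteq> (\<Union>x\<in>k. ball x (1 / Suc i))" using T(3) by blast
      have "z n \<in> (\<Union>x\<in>k \<union> z ` {..<i}. ball x d)" for n
      proof (cases "n < i")
        case True
        then show ?thesis using d by (intro UN_I[of "z n"]) auto
      next
        case False
        then have "z n \<in> T i" using z[of i n] by auto
        then show ?thesis using k i by force
      qed
      then have "range z \<subseteq> (\<Union>x\<in>k \<union> z ` {..<i}. ball x d)" by blast
      moreover have "finite (k \<union> z ` {..<i})" using k(1) by simp
      ultimately show "\<exists>k. finite k \<and> range z \<subseteq> (\<Union>x\<in>k. ball x d)" by blast
    qed
    moreover have "\<forall>n. z n \<in> closure (range z)"
      using closure_subset[of "range z"] by blast
    ultimately obtain l r where r: "strict_mono r" "(z \<circ> r) \<longlonglongrightarrow> l"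
      unfolding compact_eq_seq_compact_metric seq_compact_def by blast
    have "l \<in> A i" for i
    proof -
      have "\<forall>\<^sub>F n in sequentially. (z \<circ> r) n \<in> F i"
        using eventually_ge_at_top[of i]
      proof eventually_elim
        fix n assume "i \<le> n"
        then have "i \<le> r n" using seq_suble[OF r(1), of n] by simp
        from z[OF this] show "(z \<circ> r) n \<in> F i" by simp
      qed
      then have "l \<in> F i"
        using Lim_in_closed_set[OF F(2)[of i] _ _ r(2)] by simp
      then show ?thesis using F(3) by blast
    qed
    with A(3) show False by blast
  qed
  then obtain N where N: "(\<Inter>i\<le>N. F i \<inter> T i) = {}" ..
  have small: "f (A N) < e"
  proof -
    let ?B = "\<lambda>i. (A i - F i) \<union> (- T i)"
    have AR: "A i \<in> R" for i using A(1) by auto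
    have B: "?B i \<in> R" for i using AR F(1) T(1) compl by (intro Un Diff) auto
    have "A N \<subseteq> (\<Union>i\<le>N. ?B i)"
    proof
      fix x assume x: "x \<in> A N"
      obtain i where i: "i \<le> N" "x \<notin> F i \<inter> T i" using N by blast
      have "x \<in> A i" using x decseqD[OF A(2) i(1)] by blast
      with i show "x \<in> (\<Union>i\<le>N. ?B i)" by blast
    qed
    then have "f (A N) \<le> f (\<Union>i\<le>N. ?B i)" using B AR by (intro content_mono content_UN_le) auto
    also have "\<dots> \<le> (\<Sum>i\<le>N. f (?B i))" using B by (intro content_UN_le)
    also have "\<dots> \<le> (\<Sum>i\<le>N. e / 2 ^ (i + 1))"
    proof (rule sum_mono)
      fix i
      have "f (?B i) \<le> f (A i - F i) + f (- T i)"
        by (intro content_subadd Diff AR F compl T)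
      also have "\<dots> \<le> \<delta> i + \<delta> i" using F(4)[of i] T(2)[of i] by simp
      finally show "f (?B i) \<le> e / 2 ^ (i + 1)" by (simp add: \<delta>_def field_simps)
    qed
    also have "(\<Sum>i\<le>N. e / 2 ^ (i + 1)) = e * (1 - 1 / 2 ^ (N + 1))"
      by (induction N) (simp_all add: field_simps)
    also have "\<dots> < e * 1" using \<open>e > 0\<close> by (intro mult_strict_left_mono) auto
    finally show ?thesis by simp
  qed
  show "\<exists>no. \<forall>n\<ge>no. norm (f (A n) - 0) < e"
  proof (intro exI[of _ N] allI impI)
    fix n assume "N \<le> n"
    then have "f (A n) \<le> f (A N)" using A(1) by (intro content_mono decseqD[OF A(2)]) auto
    moreover have "0 \<le> f (A n)" using A(1) by (intro nonneg) auto
    ultimately show "norm (f (A n) - 0) < e" using small by simp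
  qed
qed

lemma extends_to_measure:
  assumes inner: "\<And>A. A \<in> R \<Longrightarrow> closed_regular A" and tight: tight
  obtains \<pi> where "space \<pi> = UNIV" "sets \<pi> = sigma_sets UNIV R"
    "\<And>A. A \<in> R \<Longrightarrow> emeasure \<pi> A = ennreal (f A)"
proof -
  have "\<exists>\<mu>. (\<forall>s\<in>R. \<mu> s = ennreal (f s)) \<and> measure_space UNIV (sigma_sets UNIV R) \<mu>"
  proof (rule caratheodory_empty_continuous)
    show "positive R (\<lambda>A. ennreal (f A))" by (simp add: positive_def content_empty)
    show "Measure_Space.additive R (\<lambda>A. ennreal (f A))"
      by (auto simp: Measure_Space.additive_def add nonneg ennreal_plus[symmetric] simp del: ennreal_plus)
    fix A assume "range A \<subseteq> R" "decseq A" "(\<Inter>i. A i) = {}"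
    from empty_continuous[OF inner tight this]
    show "(\<lambda>i. ennreal (f (A i))) \<longlonglongrightarrow> 0"
      using tendsto_ennrealI[of "\<lambda>i. f (A i)" 0] by simp
  qed simp
  then obtain \<mu> where \<mu>: "\<And>s. s \<in> R \<Longrightarrow> \<mu> s = ennreal (f s)" "measure_space UNIV (sigma_sets UNIV R) \<mu>"
    by blast
  show ?thesis
  proof (rule that[of "measure_of UNIV R \<mu>"])
    show "emeasure (measure_of UNIV R \<mu>) A = ennreal (f A)" if "A \<in> R" for A
      using \<mu> that
      by (subst emeasure_measure_of[OF refl])
         (auto simp: measure_space_def intro: sigma_sets.Basic)
  qed auto
qed

end

section \<open>Transfer of regularity and tightness from a marginal\<close>

text \<open>This is why closures of basic sets are put into the algebra along with the basic sets: every open set is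
  then a countable union of closed members.\<close>

lemma basis_closure_exhausts:
  fixes U :: "'x::metric_space set"
  assumes B: "topological_basis B" and U: "open U"
  shows "\<Union>{closure V | V. V \<in> B \<and> closure V \<subseteq> U} = U"
proof
  show "U \<subseteq> \<Union>{closure V | V. V \<in> B \<and> closure V \<subseteq> U}"
  proof
    fix x assume "x \<in> U"
    then obtain e where e: "e > 0" "cball x e \<subseteq> U" using U open_contains_cball by blast
    obtain V where V: "V \<in> B" "x \<in> V" "V \<subseteq> ball x e"
      using topological_basisE[OF B open_ball[of x e], of x] e by auto
    have "closure V \<subseteq> cball x e"
      using V(3) by (intro closure_minimal) (auto intro: less_imp_le)
    with V e closure_subset[of V] show "x \<in> \<Union>{closure V | V. V \<in> B \<and> closure V \<subseteq> U}" by blast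
  qed
qed auto

lemma finite_subfamily_almost_covers:
  assumes \<mu>: "finite_measure \<mu>" and C: "countable C" "\<And>A. A \<in> C \<Longrightarrow> A \<in> sets \<mu>" and e: "0 < (e::real)"
  obtains F where "finite F" "F \<subseteq> C" "measure \<mu> (\<Union>C - \<Union>F) < e"
proof (cases "C = {}")
  case True
  then show ?thesis using e by (intro that[of "{}"]) auto
next
  case False
  interpret finite_measure \<mu> by (rule \<mu>)
  define A where "A n = \<Union>C - \<Union>(from_nat_into C ` {..n})" for n
  have "from_nat_into C n \<in> sets \<mu>" for n using False by (intro C(2) from_nat_into)
  moreover have "\<Union>C \<in> sets \<mu>" using C by (intro sets.countable_Union) auto
  ultimately have "range A \<subseteq> sets \<mu>" by (auto simp: A_def)
  moreover have "decseq A" by (force simp: A_def decseq_def)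
  ultimately have "(\<lambda>n. measure \<mu> (A n)) \<longlonglongrightarrow> measure \<mu> (\<Inter>n. A n)"
    by (intro finite_Lim_measure_decseq)
  also have "(\<Inter>n. A n) = {}"
  proof -
    have "x \<notin> (\<Inter>n. A n)" for x
    proof
      assume x: "x \<in> (\<Inter>n. A n)"
      then have "x \<in> \<Union>C" by (auto simp: A_def)
      then obtain n where "x \<in> from_nat_into C n"
        using range_from_nat_into[OF False C(1)] by blast
      then have "x \<notin> A n" by (auto simp: A_def)
      with x show False by blast
    qed
    then show ?thesis by blast
  qed
  finally have "(\<lambda>n. measure \<mu> (A n)) \<longlonglongrightarrow> 0" by simp
  from order_tendstoD(2)[OF this e] obtain n where "measure \<mu> (A n) < e"
    by (auto simp: eventually_sequentially)
  then show ?thesis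
    using False by (intro that[of "from_nat_into C ` {..n}"]) (auto simp: A_def from_nat_into[OF False])
qed

text \<open>A finitely additive set function on \<open>R\<close> whose image under \<open>p\<close> agrees, as far as it is defined, with
  a Borel probability measure \<open>\<mu>\<close>. It is used with the two projections of a product.\<close>

locale content_with_marginal = topological_content R f
  for R :: "'z::complete_space set set" and f +
  fixes p :: "'z \<Rightarrow> 'x::polish_space" and \<mu> :: "'x measure" and B :: "'x set set"
  assumes p_cont: "continuous_on UNIV p"
    and \<mu>: "prob_space \<mu>" "sets \<mu> = sets borel"
    and B: "countable B" "topological_basis B"
    and basis_in_R: "V \<in> B \<Longrightarrow> p -` V \<in> R"
    and closure_in_R: "V \<in> B \<Longrightarrow> p -` closure V \<in> R"
    and f_vimage: "A \<in> sets borel \<Longrightarrow> p -` A \<in> R \<Longrightarrow> f (p -` A) = measure \<mu> A"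
begin

lemma vimage_Union_closed:
  assumes "finite F" "F \<subseteq> closure ` B"
  shows "closed (\<Union>F)" "p -` \<Union>F \<in> R"
proof -
  show "closed (\<Union>F)" using assms by (intro closed_Union) auto
  have "p -` \<Union>F = \<Union>((-`) p ` F)" by auto
  also have "\<dots> \<in> R" using assms closure_in_R by (intro finite_Union) auto
  finally show "p -` \<Union>F \<in> R" .
qed

text \<open>Countable additivity of \<open>\<mu>\<close> lets finitely many closures of basic sets exhaust \<open>U\<close> up to \<open>e\<close>, and
  the remainder is again a preimage, where \<open>f\<close> is computed by \<open>\<mu>\<close>.\<close>

lemma closed_regular_vimage_open:
  assumes U: "open U" "p -` U \<in> R"
  shows "closed_regular (p -` U)"
  unfolding closed_regular_def
proof (intro allI impI)
  fix e :: real assume e: "e > 0"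
  interpret \<mu>: prob_space \<mu> by (rule \<mu>)
  let ?C = "{closure V | V. V \<in> B \<and> closure V \<subseteq> U}"
  have "countable ?C"
    by (rule countable_subset[of _ "closure ` B"]) (use B in auto)
  moreover have "A \<in> sets \<mu>" if "A \<in> ?C" for A using that \<mu>(2) by auto
  ultimately obtain F where F: "finite F" "F \<subseteq> ?C" "measure \<mu> (\<Union>?C - \<Union>F) < e"
    by (rule finite_subfamily_almost_covers[OF \<mu>.finite_measure_axioms _ _ e])
  have F': "closed (\<Union>F)" "p -` \<Union>F \<in> R"
    using vimage_Union_closed[of F] F(1) subset_trans[OF F(2), of "closure ` B"] by blast+
  have "closed (p -` \<Union>F)" using F'(1) p_cont by (intro closed_vimage)
  moreover have "p -` U - p -` \<Union>F = p -` (U - \<Union>F)" by auto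
  then have "f (p -` U - p -` \<Union>F) = measure \<mu> (U - \<Union>F)"
    using f_vimage[of "U - \<Union>F"] Diff[OF U(2) F'(2)] U(1) F'(1) by (metis borel_closed borel_open sets.Diff)
  ultimately show "\<exists>F\<in>R. closed F \<and> F \<subseteq> p -` U \<and> f (p -` U - F) < e"
    using F F' basis_closure_exhausts[OF B(2) U(1)] by (intro bexI[of _ "p -` \<Union>F"]) auto
qed

lemma vimage_tight:
  assumes "d > 0" "e > 0"
  obtains S k where "p -` S \<in> R" "f (- (p -` S)) < e" "finite k" "S \<subseteq> (\<Union>x\<in>k. ball x d)"
proof -
  interpret \<mu>: prob_space \<mu> by (rule \<mu>)
  let ?C = "{closure V | V. V \<in> B \<and> (\<exists>x. closure V \<subseteq> ball x d)}"
  have "x \<in> \<Union>?C" for x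
  proof -
    have "x \<in> \<Union>{closure V | V. V \<in> B \<and> closure V \<subseteq> ball x d}"
      using basis_closure_exhausts[OF B(2) open_ball[of x d]] \<open>d > 0\<close> by simp
    then show ?thesis by blast
  qed
  then have UC: "\<Union>?C = UNIV" by blast
  have "countable ?C"
    by (rule countable_subset[of _ "closure ` B"]) (use B in auto)
  moreover have "A \<in> sets \<mu>" if "A \<in> ?C" for A using that \<mu>(2) by auto
  ultimately obtain F where F: "finite F" "F \<subseteq> ?C" "measure \<mu> (\<Union>?C - \<Union>F) < e"
    by (rule finite_subfamily_almost_covers[OF \<mu>.finite_measure_axioms _ _ \<open>e > 0\<close>])
  have F': "closed (\<Union>F)" "p -` \<Union>F \<in> R"
    using vimage_Union_closed[of F] F(1) subset_trans[OF F(2), of "closure ` B"] by blast+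
  have "\<forall>A\<in>F. \<exists>x. A \<subseteq> ball x d" using F(2) by auto
  then obtain x where x: "\<And>A. A \<in> F \<Longrightarrow> A \<subseteq> ball (x A) d" by metis
  have "- (p -` \<Union>F) = p -` (UNIV - \<Union>F)" by auto
  then have "f (- (p -` \<Union>F)) < e"
    using f_vimage[of "UNIV - \<Union>F"] compl[OF F'(2)] borel_closed[OF F'(1)] F(3) UC
    by (metis borel_comp Compl_eq_Diff_UNIV)
  moreover have "\<Union>F \<subseteq> (\<Union>y\<in>x ` F. ball y d)" using x by blast
  ultimately show ?thesis
    using F(1) F'(2) by (intro that[of "\<Union>F" "x ` F"]) simp_all
qed

lemma distr_extension_eq_marginal:
  assumes \<pi>: "sets \<pi> = sets borel" "\<And>A. A \<in> R \<Longrightarrow> emeasure \<pi> A = ennreal (f A)"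
  shows "distr \<pi> borel p = \<mu>"
proof -
  interpret \<mu>: prob_space \<mu> by (rule \<mu>)
  have sp: "space \<pi> = UNIV" using sets_eq_imp_space_eq[OF \<pi>(1)] by simp
  have p_meas: "p \<in> measurable \<pi> borel"
    using borel_measurable_continuous_onI[OF p_cont] measurable_cong_sets[OF \<pi>(1) refl] by blast
  let ?G = "{A \<in> sets borel. p -` A \<in> R}"
  have borel_eq: "sets borel = sigma_sets UNIV ?G"
  proof
    have "B \<subseteq> ?G" using basis_in_R topological_basis_open[OF B(2)] by auto
    then show "sets borel \<subseteq> sigma_sets UNIV ?G"
      by (subst borel_eq_countable_basis[OF B]) (auto intro!: sigma_sets_mono')
    show "sigma_sets UNIV ?G \<subseteq> sets borel"
      using sets.sigma_sets_subset[of ?G borel] by auto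
  qed
  show ?thesis
  proof (rule measure_eqI_generator_eq[where E="?G" and \<Omega>=UNIV and A="\<lambda>_. UNIV"])
    show "Int_stable ?G" by (auto simp: Int_stable_def vimage_Int)
    show "sets (distr \<pi> borel p) = sigma_sets UNIV ?G" "sets \<mu> = sigma_sets UNIV ?G"
      using borel_eq \<mu>(2) by auto
    fix A assume A: "A \<in> ?G"
    then have "emeasure (distr \<pi> borel p) A = ennreal (f (p -` A))"
      using p_meas by (simp add: emeasure_distr sp \<pi>(2))
    then show "emeasure (distr \<pi> borel p) A = emeasure \<mu> A"
      using A f_vimage by (simp add: \<mu>.emeasure_eq_measure)
  next
    fix i :: nat
    show "emeasure (distr \<pi> borel p) UNIV \<noteq> \<infinity>"
      using p_meas \<pi>(2)[of UNIV] top by (simp add: emeasure_distr sp)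
  qed (use top in auto)
qed

end

section \<open>Couplings as finitely additive sequences on a countable algebra\<close>

text \<open>Terms of Boolean set operations; there are countably many of them, which is a direct way to see that a
  countable family generates a countable algebra.\<close>

datatype set_term = Gen nat | Neg set_term | Join set_term set_term

instance set_term :: countable
  by countable_datatype

primrec interp :: "(nat \<Rightarrow> 'z set) \<Rightarrow> set_term \<Rightarrow> 'z set" where
  "interp g (Gen n) = g n"
| "interp g (Neg s) = - interp g s"
| "interp g (Join s t) = interp g s \<union> interp g t"

lemma countable_generated_algebra:
  fixes G :: "'z set set"
  assumes G: "countable G" "G \<noteq> {}"
  obtains E :: "nat \<Rightarrow> 'z set" where "algebra UNIV (range E)" "G \<subseteq> range E"
    "\<And>P i. (\<And>A. A \<in> G \<Longrightarrow> P A) \<Longrightarrow> (\<And>A. A \<in> range E \<Longrightarrow> P A \<Longrightarrow> P (- A)) \<Longrightarrow>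
       (\<And>A B. A \<in> range E \<Longrightarrow> B \<in> range E \<Longrightarrow> P A \<Longrightarrow> P B \<Longrightarrow> P (A \<union> B)) \<Longrightarrow> P (E i)"
proof -
  define g where "g = from_nat_into G"
  have g: "range g = G" using G by (simp add: g_def)
  define E where "E i = interp g (from_nat i)" for i
  have range_E: "range E = range (interp g)"
  proof
    have "interp g s = E (to_nat s)" for s by (simp add: E_def)
    then show "range (interp g) \<subseteq> range E" by auto
  qed (auto simp: E_def)
  have mem: "interp g s \<in> range E" for s by (simp add: range_E)
  show ?thesis
  proof
    show "algebra UNIV (range E)"
      unfolding algebra_iff_Un
    proof (intro conjI ballI)
      have "interp g (Neg (Join (Gen 0) (Neg (Gen 0)))) = {}" by simp
      then show "{} \<in> range E" by (metis mem)
    next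
      fix A assume "A \<in> range E"
      then obtain s where "A = interp g s" by (auto simp: range_E)
      then have "interp g (Neg s) = UNIV - A" by auto
      then show "UNIV - A \<in> range E" by (metis mem)
    next
      fix A B assume "A \<in> range E" "B \<in> range E"
      then obtain s t where "A = interp g s" "B = interp g t" by (auto simp: range_E)
      then have "interp g (Join s t) = A \<union> B" by simp
      then show "A \<union> B \<in> range E" by (metis mem)
    qed simp
    have "g n \<in> range E" for n using mem[of "Gen n"] by simp
    then show "G \<subseteq> range E" unfolding g[symmetric] by auto
    fix P i
    assume P: "\<And>A. A \<in> G \<Longrightarrow> P A" "\<And>A. A \<in> range E \<Longrightarrow> P A \<Longrightarrow> P (- A)"
      "\<And>A B. A \<in> range E \<Longrightarrow> B \<in> range E \<Longrightarrow> P A \<Longrightarrow> P B \<Longrightarrow> P (A \<union> B)"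
    have "P (interp g s)" for s
    proof (induction s)
      case (Gen n) then show ?case using P(1) g by auto
    next
      case (Neg s) then show ?case using P(2)[OF mem] by simp
    next
      case (Join s t) then show ?case using P(3)[OF mem mem] by simp
    qed
    then show "P (E i)" by (simp add: E_def)
  qed
qed

text \<open>The rule \<open>E_induct\<close> says that nothing but the cylinders over basic sets and their closures
  generates the algebra; \<open>E\<close> enumerates it, possibly with repetitions.\<close>

locale cylinder_algebra =
  fixes E :: "nat \<Rightarrow> ('a::polish_space \<times> 'b::polish_space) set"
    and BX :: "'a set set" and BY :: "'b set set"
  assumes algebra_E: "algebra UNIV (range E)"
    and BX: "countable BX" "topological_basis BX"
    and BY: "countable BY" "topological_basis BY"
    and basis_in_E: "V \<in> BX \<Longrightarrow> fst -` V \<in> range E" "V \<in> BX \<Longrightarrow> fst -` closure V \<in> range E"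
      "W \<in> BY \<Longrightarrow> snd -` W \<in> range E" "W \<in> BY \<Longrightarrow> snd -` closure W \<in> range E"
    and E_induct: "(\<And>V. V \<in> BX \<Longrightarrow> P (fst -` V)) \<Longrightarrow> (\<And>V. V \<in> BX \<Longrightarrow> P (fst -` closure V)) \<Longrightarrow>
      (\<And>W. W \<in> BY \<Longrightarrow> P (snd -` W)) \<Longrightarrow> (\<And>W. W \<in> BY \<Longrightarrow> P (snd -` closure W)) \<Longrightarrow>
      (\<And>A. A \<in> range E \<Longrightarrow> P A \<Longrightarrow> P (- A)) \<Longrightarrow>
      (\<And>A B. A \<in> range E \<Longrightarrow> B \<in> range E \<Longrightarrow> P A \<Longrightarrow> P B \<Longrightarrow> P (A \<union> B)) \<Longrightarrow> P (E i)"

lemma ex_cylinder_algebra: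
  "\<exists>(E :: nat \<Rightarrow> ('a::polish_space \<times> 'b::polish_space) set) BX BY. cylinder_algebra E BX BY"
proof -
  obtain BX :: "'a set set" where BX: "countable BX" "topological_basis BX"
    using ex_countable_basis by auto
  obtain BY :: "'b set set" where BY: "countable BY" "topological_basis BY"
    using ex_countable_basis by auto
  define G :: "('a \<times> 'b) set set" where
    "G = (-`) fst ` BX \<union> (-`) fst ` closure ` BX \<union> (-`) snd ` BY \<union> (-`) snd ` closure ` BY"
  have "BX \<noteq> {}" using topological_basisE[OF BX(2) open_UNIV UNIV_I] by blast
  then have "countable G" "G \<noteq> {}" using BX BY by (auto simp: G_def)
  then show ?thesis
  proof (rule countable_generated_algebra)
    fix E :: "nat \<Rightarrow> ('a \<times> 'b) set"
    assume E: "algebra UNIV (range E)" "G \<subseteq> range E"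
      "\<And>P i. (\<And>A. A \<in> G \<Longrightarrow> P A) \<Longrightarrow> (\<And>A. A \<in> range E \<Longrightarrow> P A \<Longrightarrow> P (- A)) \<Longrightarrow>
         (\<And>A B. A \<in> range E \<Longrightarrow> B \<in> range E \<Longrightarrow> P A \<Longrightarrow> P B \<Longrightarrow> P (A \<union> B)) \<Longrightarrow> P (E i)"
    have mem: "V \<in> BX \<Longrightarrow> fst -` V \<in> range E" "V \<in> BX \<Longrightarrow> fst -` closure V \<in> range E"
      "W \<in> BY \<Longrightarrow> snd -` W \<in> range E" "W \<in> BY \<Longrightarrow> snd -` closure W \<in> range E" for V W
      by (rule subsetD[OF E(2)], simp add: G_def)+
    have "cylinder_algebra E BX BY"
    proof (intro cylinder_algebra.intro)
      fix P i
      assume P: "\<And>V. V \<in> BX \<Longrightarrow> P (fst -` V)" "\<And>V. V \<in> BX \<Longrightarrow> P (fst -` closure V)"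
        "\<And>W. W \<in> BY \<Longrightarrow> P (snd -` W)" "\<And>W. W \<in> BY \<Longrightarrow> P (snd -` closure W)"
        "\<And>A. A \<in> range E \<Longrightarrow> P A \<Longrightarrow> P (- A)"
        "\<And>A B. A \<in> range E \<Longrightarrow> B \<in> range E \<Longrightarrow> P A \<Longrightarrow> P B \<Longrightarrow> P (A \<union> B)"
      show "P (E i)"
      proof (rule E(3))
        show "P A" if "A \<in> G" for A using that unfolding G_def by (elim UnE imageE) (simp_all add: P(1-4))
      qed (rule P(5,6); assumption)+
    qed (fact E(1) BX BY mem)+
    then show ?thesis by blast
  qed
qed

context cylinder_algebra
begin

sublocale E: algebra UNIV "range E" by (rule algebra_E)

lemma compl_in_E: "A \<in> range E \<Longrightarrow> - A \<in> range E"
  using E.compl_sets by (simp add: Compl_eq_Diff_UNIV)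

lemma fst_vimage_borel: "A \<in> sets borel \<Longrightarrow> (fst :: 'a \<times> 'b \<Rightarrow> 'a) -` A \<in> sets borel"
  using measurable_sets[OF borel_measurable_continuous_onI[OF continuous_on_fst[OF continuous_on_id]]]
  by simp

lemma snd_vimage_borel: "A \<in> sets borel \<Longrightarrow> (snd :: 'a \<times> 'b \<Rightarrow> 'b) -` A \<in> sets borel"
  using measurable_sets[OF borel_measurable_continuous_onI[OF continuous_on_snd[OF continuous_on_id]]]
  by simp

lemma E_borel: "E i \<in> sets borel"
proof (rule E_induct)
  show "(fst :: 'a \<times> 'b \<Rightarrow> 'a) -` V \<in> sets borel" if "V \<in> BX" for V
    by (rule fst_vimage_borel, rule borel_open, rule topological_basis_open[OF BX(2) that])
  show "(snd :: 'a \<times> 'b \<Rightarrow> 'b) -` V \<in> sets borel" if "V \<in> BY" for V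
    by (rule snd_vimage_borel, rule borel_open, rule topological_basis_open[OF BY(2) that])
  show "(fst :: 'a \<times> 'b \<Rightarrow> 'a) -` closure V \<in> sets borel" for V
    by (rule fst_vimage_borel, rule borel_closed, rule closed_closure)
  show "(snd :: 'a \<times> 'b \<Rightarrow> 'b) -` closure V \<in> sets borel" for V
    by (rule snd_vimage_borel, rule borel_closed, rule closed_closure)
qed (rule borel_comp sets.Un; assumption)+

lemma E_topological_basis:
  assumes "open U" "z \<in> U"
  obtains i where "z \<in> E i" "E i \<subseteq> U"
proof -
  obtain A B where AB: "open A" "open B" "z \<in> A \<times> B" "A \<times> B \<subseteq> U"
    using assms by (rule open_prod_elim)
  obtain V where V: "V \<in> BX" "fst z \<in> V" "V \<subseteq> A"
    using AB(3) by (auto elim: topological_basisE[OF BX(2) AB(1)])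
  obtain W where W: "W \<in> BY" "snd z \<in> W" "W \<subseteq> B"
    using AB(3) by (auto elim: topological_basisE[OF BY(2) AB(2)])
  have "fst -` V \<inter> snd -` W \<in> range E"
    using basis_in_E V W by (intro E.Int) auto
  then obtain i where "E i = fst -` V \<inter> snd -` W" by auto
  moreover have "fst -` V \<inter> snd -` W \<subseteq> A \<times> B" using V W by auto
  ultimately show ?thesis using V W AB(4) by (intro that[of i]) auto
qed

text \<open>The basic rectangles belong to the algebra, so every open set is a countable union of members.\<close>

lemma sigma_sets_E: "sigma_sets UNIV (range E) = sets borel"
proof
  show "sigma_sets UNIV (range E) \<subseteq> sets borel"
    using sets.sigma_sets_subset[of "range E" borel] E_borel by auto
  have "U \<in> sigma_sets UNIV (range E)" if "open U" for U
  proof -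
    have "U = (\<Union>i\<in>{i. E i \<subseteq> U}. E i)" using E_topological_basis[OF that] by blast
    also have "\<dots> \<in> sigma_sets UNIV (range E)"
      by (intro sigma_sets_UNION) auto
    finally show ?thesis .
  qed
  then show "sets borel \<subseteq> sigma_sets UNIV (range E)"
    unfolding sets_borel using sigma_sets_mono[of "{S. open S}" UNIV "range E"] by auto
qed

text \<open>Each conjunct is a closed condition on the sequence \<open>m\<close>, in the topology of pointwise convergence.
  The last two prescribe the marginals on the cylinders that belong to the algebra.\<close>

definition coupling_values :: "'a measure \<Rightarrow> 'b measure \<Rightarrow> (nat \<Rightarrow> real) \<Rightarrow> bool" where
  "coupling_values \<mu> \<nu> m \<longleftrightarrow>
     (\<forall>i. 0 \<le> m i \<and> m i \<le> 1) \<and>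
     (\<forall>i j k. E i \<inter> E j = {} \<longrightarrow> E k = E i \<union> E j \<longrightarrow> m k = m i + m j) \<and>
     (\<forall>i. \<forall>A\<in>sets borel. E i = fst -` A \<longrightarrow> m i = measure \<mu> A) \<and>
     (\<forall>i. \<forall>B\<in>sets borel. E i = snd -` B \<longrightarrow> m i = measure \<nu> B)"

lemma coupling_values_of_coupling:
  assumes \<pi>: "\<pi> \<in> couplings \<mu> \<nu>"
  shows "coupling_values \<mu> \<nu> (\<lambda>i. measure \<pi> (E i))"
proof -
  interpret prob_space \<pi> using \<pi> by (simp add: couplings_def)
  have sets: "sets \<pi> = sets borel" using \<pi> by (simp add: couplings_def)
  have sp: "space \<pi> = UNIV" using sets_eq_imp_space_eq[OF sets] by simp
  have meas: "fst \<in> measurable \<pi> borel" "snd \<in> measurable \<pi> borel"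
    unfolding measurable_cong_sets[OF sets refl]
    by (auto intro!: borel_measurable_continuous_onI continuous_intros)
  have d: "distr \<pi> borel fst = \<mu>" "distr \<pi> borel snd = \<nu>" using \<pi> by (auto simp: couplings_def)
  show ?thesis
    unfolding coupling_values_def
  proof (intro conjI allI impI ballI)
    fix i j k assume "E i \<inter> E j = {}" "E k = E i \<union> E j"
    then show "measure \<pi> (E k) = measure \<pi> (E i) + measure \<pi> (E j)"
      using E_borel by (simp add: finite_measure_Union sets)
  next
    fix i A assume "A \<in> sets (borel :: 'a measure)" "E i = fst -` A"
    then show "measure \<pi> (E i) = measure \<mu> A"
      using meas by (simp add: d(1)[symmetric] measure_distr sp)
  next
    fix i A assume "A \<in> sets (borel :: 'b measure)" "E i = snd -` A"
    then show "measure \<pi> (E i) = measure \<nu> A"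
      using meas by (simp add: d(2)[symmetric] measure_distr sp)
  qed simp_all
qed

text \<open>Closed regularity is checked on cylinders, where it comes from one marginal, and propagated through the
  Boolean operations, for a set together with its complement. Tightness holds
  since balls of radius \<open>d / 2\<close> in both factors multiply to a subset of a ball of radius \<open>d\<close>. Countable additivity is therefore
  automatic once both marginals are countably additive.\<close>

lemma coupling_of_coupling_values:
  assumes \<mu>: "prob_space \<mu>" "sets \<mu> = sets borel" and \<nu>: "prob_space \<nu>" "sets \<nu> = sets borel"
    and m: "coupling_values \<mu> \<nu> m"
  obtains \<pi> where "\<pi> \<in> couplings \<mu> \<nu>" "\<And>i. emeasure \<pi> (E i) = ennreal (m i)"
proof -
  have m01: "0 \<le> m i" for i using m by (simp add: coupling_values_def)
  have m_add: "m k = m i + m j" if "E i \<inter> E j = {}" "E k = E i \<union> E j" for i j k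
    using m that unfolding coupling_values_def by blast
  have m_fst: "m i = measure \<mu> A" if "A \<in> sets borel" "E i = fst -` A" for i A
    using m that unfolding coupling_values_def by blast
  have m_snd: "m i = measure \<nu> A" if "A \<in> sets borel" "E i = snd -` A" for i A
    using m that unfolding coupling_values_def by blast
  define f where "f A = m (SOME i. E i = A)" for A
  obtain e where e: "E e = {}" using E.empty_sets by (metis rangeE)
  \<comment> \<open>The enumeration may repeat sets; additivity with the empty set makes \<open>m\<close> depend on the set only.\<close>
  have m_eq: "m i = m j" if "E i = E j" for i j
  proof -
    have "m e = 0" using m_add[of e e e] e by simp
    moreover have "m j = m i + m e" by (rule m_add) (simp_all add: e that)
    ultimately show ?thesis by simp
  qed
  have f: "f (E i) = m i" for i
  proof -
    have "E (SOME j. E j = E i) = E i" by (rule someI) (rule refl)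
    then show ?thesis unfolding f_def by (rule m_eq)
  qed
  interpret content: topological_content "range E" f
  proof
    show "0 \<le> f A" if "A \<in> range E" for A using that m01 f by auto
    fix A B assume AB: "A \<in> range E" "B \<in> range E" "A \<inter> B = {}"
    then obtain i j where ij: "A = E i" "B = E j" by auto
    have "A \<union> B \<in> range E" using AB by (intro E.Un)
    then obtain k where k: "E k = A \<union> B" by (metis rangeE)
    then have "m k = m i + m j" using ij AB by (intro m_add) auto
    then show "f (A \<union> B) = f A + f B" unfolding k[symmetric] by (simp add: ij f)
  qed
  interpret fst: content_with_marginal "range E" f fst \<mu> BX
  proof (intro content_with_marginal.intro content_with_marginal_axioms.intro)
    show "f (fst -` A) = measure \<mu> A" if A: "A \<in> sets borel" "fst -` A \<in> range E" for A
    proof -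
      obtain i where i: "E i = fst -` A" using A(2) by (metis rangeE)
      then show ?thesis using m_fst[OF A(1) i] f[of i] by simp
    qed
  qed (fact \<mu> BX basis_in_E content.topological_content_axioms | intro continuous_intros)+
  interpret snd: content_with_marginal "range E" f snd \<nu> BY
  proof (intro content_with_marginal.intro content_with_marginal_axioms.intro)
    show "f (snd -` A) = measure \<nu> A" if A: "A \<in> sets borel" "snd -` A \<in> range E" for A
    proof -
      obtain i where i: "E i = snd -` A" using A(2) by (metis rangeE)
      then show ?thesis using m_snd[OF A(1) i] f[of i] by simp
    qed
  qed (fact \<nu> BY basis_in_E content.topological_content_axioms | intro continuous_intros)+
  have regular_closed: "content.closed_regular F" if "F \<in> range E" "closed F" for F
    unfolding content.closed_regular_def
    by (intro allI impI bexI[of _ F]) (simp_all add: that content.content_empty)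
  have regular: "content.closed_regular (E i) \<and> content.closed_regular (- E i)" for i
  proof (rule E_induct)
    fix V assume V: "V \<in> BX"
    note o = topological_basis_open[OF BX(2) V]
    show "content.closed_regular (fst -` V) \<and> content.closed_regular (- fst -` V)"
    proof
      show "content.closed_regular (fst -` V)"
        using o basis_in_E(1)[OF V] by (rule fst.closed_regular_vimage_open)
      have "closed (fst -` (- V))" using o by (intro closed_vimage_fst) auto
      then show "content.closed_regular (- fst -` V)"
        using compl_in_E[OF basis_in_E(1)[OF V]] by (intro regular_closed) (simp_all add: vimage_Compl)
    qed
    show "content.closed_regular (fst -` closure V) \<and> content.closed_regular (- fst -` closure V)"
    proof
      show "content.closed_regular (fst -` closure V)"
        using basis_in_E(2)[OF V] by (intro regular_closed closed_vimage_fst closed_closure)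
      have "content.closed_regular (fst -` (- closure V))"
        using compl_in_E[OF basis_in_E(2)[OF V]]
        by (intro fst.closed_regular_vimage_open) (simp_all add: vimage_Compl open_Compl)
      then show "content.closed_regular (- fst -` closure V)" by (simp add: vimage_Compl)
    qed
  next
    fix V assume V: "V \<in> BY"
    note o = topological_basis_open[OF BY(2) V]
    show "content.closed_regular (snd -` V) \<and> content.closed_regular (- snd -` V)"
    proof
      show "content.closed_regular (snd -` V)"
        using o basis_in_E(3)[OF V] by (rule snd.closed_regular_vimage_open)
      have "closed (snd -` (- V))" using o by (intro closed_vimage_snd) auto
      then show "content.closed_regular (- snd -` V)"
        using compl_in_E[OF basis_in_E(3)[OF V]] by (intro regular_closed) (simp_all add: vimage_Compl)
    qed
    show "content.closed_regular (snd -` closure V) \<and> content.closed_regular (- snd -` closure V)"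
    proof
      show "content.closed_regular (snd -` closure V)"
        using basis_in_E(4)[OF V] by (intro regular_closed closed_vimage_snd closed_closure)
      have "content.closed_regular (snd -` (- closure V))"
        using compl_in_E[OF basis_in_E(4)[OF V]]
        by (intro snd.closed_regular_vimage_open) (simp_all add: vimage_Compl open_Compl)
      then show "content.closed_regular (- snd -` closure V)" by (simp add: vimage_Compl)
    qed
  next
    fix A B assume AB: "A \<in> range E" "B \<in> range E"
      and r: "content.closed_regular A \<and> content.closed_regular (- A)"
        "content.closed_regular B \<and> content.closed_regular (- B)"
    show "content.closed_regular (A \<union> B) \<and> content.closed_regular (- (A \<union> B))"
      using content.closed_regular_Un[OF AB] content.closed_regular_Int[OF compl_in_E compl_in_E, OF AB] r
      by simp
  qed simp
  have tight: "content.tight"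
    unfolding content.tight_def
  proof (intro allI impI)
    fix d e :: real assume "d > 0" "e > 0"
    then have pos: "d / 2 > 0" "e / 2 > 0" by auto
    obtain S k where S: "fst -` S \<in> range E" "f (- (fst -` S)) < e / 2" "finite k"
        "S \<subseteq> (\<Union>x\<in>k. ball x (d / 2))"
      by (rule fst.vimage_tight[OF pos])
    obtain T l where T: "snd -` T \<in> range E" "f (- (snd -` T)) < e / 2" "finite l"
        "T \<subseteq> (\<Union>y\<in>l. ball y (d / 2))"
      by (rule snd.vimage_tight[OF pos])
    show "\<exists>T\<in>range E. f (- T) < e \<and> (\<exists>k. finite k \<and> T \<subseteq> (\<Union>x\<in>k. ball x d))"
    proof (intro bexI[of _ "fst -` S \<inter> snd -` T"] conjI exI[of _ "k \<times> l"])
      have "f (- (fst -` S \<inter> snd -` T)) \<le> f (- fst -` S) + f (- snd -` T)"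
        using content.content_subadd[OF compl_in_E compl_in_E, OF S(1) T(1)] by simp
      with S(2) T(2) show "f (- (fst -` S \<inter> snd -` T)) < e" by simp
      show "fst -` S \<inter> snd -` T \<subseteq> (\<Union>x\<in>k \<times> l. ball x d)"
      proof
        fix z assume z: "z \<in> fst -` S \<inter> snd -` T"
        then have "fst z \<in> (\<Union>x\<in>k. ball x (d / 2))" "snd z \<in> (\<Union>y\<in>l. ball y (d / 2))"
          using subsetD[OF S(4)] subsetD[OF T(4)] by auto
        then obtain x y where xy: "x \<in> k" "dist x (fst z) < d / 2" "y \<in> l" "dist y (snd z) < d / 2"
          by auto
        have "dist (x, y) z \<le> dist x (fst z) + dist y (snd z)"
          by (simp add: dist_prod_def sqrt_sum_squares_le_sum)
        with xy show "z \<in> (\<Union>x\<in>k \<times> l. ball x d)" by (intro UN_I[of "(x, y)"]) auto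
      qed
      show "finite (k \<times> l)" using S(3) T(3) by simp
      show "fst -` S \<inter> snd -` T \<in> range E" using S(1) T(1) by (rule E.Int)
    qed
  qed
  have "content.closed_regular A" if "A \<in> range E" for A using that regular by auto
  from content.extends_to_measure[OF this tight] obtain \<pi> where \<pi>: "space \<pi> = UNIV"
      "sets \<pi> = sigma_sets UNIV (range E)" "\<And>A. A \<in> range E \<Longrightarrow> emeasure \<pi> A = ennreal (f A)"
    by blast
  then have sets: "sets \<pi> = sets borel" by (simp add: sigma_sets_E)
  have m1: "f UNIV = 1"
    using fst.f_vimage[of UNIV] E.top prob_space.prob_space[OF \<mu>(1)] sets_eq_imp_space_eq[OF \<mu>(2)] by simp
  show ?thesis
  proof (rule that)
    have "prob_space \<pi>" using \<pi>(3)[OF E.top] m1 \<pi>(1) by (intro prob_spaceI) simp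
    then show "\<pi> \<in> couplings \<mu> \<nu>"
      using sets fst.distr_extension_eq_marginal[OF sets \<pi>(3)] snd.distr_extension_eq_marginal[OF sets \<pi>(3)]
      by (simp add: couplings_def)
    show "emeasure \<pi> (E i) = ennreal (m i)" for i using \<pi>(3)[of "E i"] f by simp
  qed
qed

end

section \<open>Integrals of continuous costs through step functions\<close>

context cylinder_algebra
begin

text \<open>The absolute value allows all rational coefficients as codes while keeping the functions
  nonnegative; the countably many lists code all step functions that are needed.\<close>

definition step :: "(rat \<times> nat) list \<Rightarrow> 'a \<times> 'b \<Rightarrow> ennreal" where
  "step l z = (\<Sum>(q, i)\<leftarrow>l. ennreal \<bar>of_rat q\<bar> * indicator (E i) z)"

definition step_value :: "(rat \<times> nat) list \<Rightarrow> (nat \<Rightarrow> real) \<Rightarrow> real" where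
  "step_value l m = (\<Sum>(q, i)\<leftarrow>l. \<bar>of_rat q\<bar> * m i)"

lemma step_simps:
  "step [] z = 0"
  "step ((q, i) # l) z = ennreal \<bar>of_rat q\<bar> * indicator (E i) z + step l z"
  "step (l @ l') z = step l z + step l' z"
  by (simp_all add: step_def)

lemma step_value_simps:
  "step_value [] m = 0"
  "step_value ((q, i) # l) m = \<bar>of_rat q\<bar> * m i + step_value l m"
  by (simp_all add: step_value_def)

lemma step_measurable[measurable]: "step l \<in> borel_measurable borel"
proof -
  have [measurable]: "E i \<in> sets borel" for i by (rule E_borel)
  show ?thesis
  proof (induction l)
    case Nil
    then show ?case by (simp add: step_simps[abs_def])
  next
    case (Cons p l)
    note [measurable] = Cons
    obtain q i where p: "p = (q, i)" by (cases p)
    have "step (p # l) = (\<lambda>z. ennreal \<bar>of_rat q\<bar> * indicator (E i) z + step l z)"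
      unfolding p by (rule ext) (rule step_simps)
    then show ?case by simp
  qed
qed

lemma step_value_nonneg:
  assumes "\<And>i. 0 \<le> m i"
  shows "0 \<le> step_value l m"
  using assms by (induction l) (auto simp: step_value_simps)

lemma nn_integral_step:
  assumes sets: "sets \<pi> = sets borel" and m: "\<And>i. emeasure \<pi> (E i) = ennreal (m i)" "\<And>i. 0 \<le> m i"
  shows "(\<integral>\<^sup>+z. step l z \<partial>\<pi>) = ennreal (step_value l m)"
proof -
  have [measurable]: "E i \<in> sets \<pi>" for i using E_borel sets by simp
  have [measurable]: "step l \<in> borel_measurable \<pi>" for l
    using step_measurable measurable_cong_sets[OF sets refl] by blast
  show ?thesis
  proof (induction l)
    case Nil
    then show ?case by (simp add: step_simps step_value_simps)
  next
    case (Cons p l)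
    obtain q i where p: "p = (q, i)" by (cases p)
    have "(\<integral>\<^sup>+z. step (p # l) z \<partial>\<pi>) =
        (\<integral>\<^sup>+z. ennreal \<bar>of_rat q\<bar> * indicator (E i) z \<partial>\<pi>) + (\<integral>\<^sup>+z. step l z \<partial>\<pi>)"
      unfolding p step_simps by (rule nn_integral_add) auto
    also have "\<dots> = ennreal (\<bar>of_rat q\<bar> * m i) + ennreal (step_value l m)"
      by (simp add: Cons nn_integral_cmult_indicator m ennreal_mult)
    also have "\<dots> = ennreal (step_value (p # l) m)"
      using m(2) step_value_nonneg[of m l] by (simp add: p step_value_simps ennreal_plus)
    finally show ?case .
  qed
qed

lemma finite_range_step: "finite (range (step l))"
proof (induction l)
  case Nil
  then show ?case by (simp add: step_simps)
next
  case (Cons p l)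
  obtain q i where p: "p = (q, i)" by (cases p)
  have "range (step (p # l)) \<subseteq> (\<lambda>(x, y). x + y) ` ({0, ennreal \<bar>of_rat q\<bar>} \<times> range (step l))"
  proof
    fix y assume "y \<in> range (step (p # l))"
    then obtain z where "y = ennreal \<bar>of_rat q\<bar> * indicator (E i) z + step l z"
      by (auto simp: p step_simps)
    then show "y \<in> (\<lambda>(x, y). x + y) ` ({0, ennreal \<bar>of_rat q\<bar>} \<times> range (step l))"
      by (intro image_eqI[of _ _ "(ennreal \<bar>of_rat q\<bar> * indicator (E i) z, step l z)"])
         (auto simp: indicator_def)
  qed
  moreover have "finite \<dots>" using Cons by simp
  ultimately show ?case by (rule finite_subset)
qed

text \<open>A maximum of multiples of indicators is a sum of such after refinement. The extra set \<open>E j\<close> and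
  floor \<open>r\<close> make the induction work: splitting \<open>E j\<close> along the first set \<open>E i\<close> raises the floor on
  one part and leaves it unchanged on the other.\<close>

lemma ex_step_eq_Sup:
  "\<exists>l. \<forall>z. step l z = indicator (E j) z *
     sup (ennreal \<bar>of_rat r\<bar>) (SUP (q, i)\<in>set ps. ennreal \<bar>of_rat q\<bar> * indicator (E i) z)"
proof (induction ps arbitrary: r j)
  case Nil
  show ?case
    by (rule exI[of _ "[(r, j)]"]) (simp add: step_simps mult.commute)
next
  case (Cons p ps)
  obtain q i where p: "p = (q, i)" by (cases p)
  have "E j \<inter> E i \<in> range E" "E j - E i \<in> range E" by auto
  then obtain j1 j2 where j: "E j1 = E j \<inter> E i" "E j2 = E j - E i" by (metis rangeE)
  obtain l1 where l1: "\<And>z. step l1 z = indicator (E j1) z *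
     sup (ennreal \<bar>of_rat (max \<bar>r\<bar> \<bar>q\<bar>)\<bar>) (SUP (q, i)\<in>set ps. ennreal \<bar>of_rat q\<bar> * indicator (E i) z)"
    using Cons by blast
  obtain l2 where l2: "\<And>z. step l2 z = indicator (E j2) z *
     sup (ennreal \<bar>of_rat r\<bar>) (SUP (q, i)\<in>set ps. ennreal \<bar>of_rat q\<bar> * indicator (E i) z)"
    using Cons by blast
  have max: "ennreal \<bar>of_rat (max \<bar>r\<bar> \<bar>q\<bar>)\<bar> = sup (ennreal \<bar>of_rat r\<bar>) (ennreal \<bar>of_rat q\<bar>)"
  proof -
    have "\<bar>of_rat (max \<bar>r\<bar> \<bar>q\<bar>)\<bar> = max \<bar>of_rat r\<bar> \<bar>of_rat q :: real\<bar>"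
    proof (cases "\<bar>r\<bar> \<le> \<bar>q\<bar>")
      case True
      then have "of_rat \<bar>r\<bar> \<le> (of_rat \<bar>q\<bar> :: real)" by (simp only: of_rat_less_eq)
      with True show ?thesis by (simp add: max_def)
    next
      case False
      then have "\<not> of_rat \<bar>r\<bar> \<le> (of_rat \<bar>q\<bar> :: real)" by (simp only: of_rat_less_eq not_False_eq_True)
      with False show ?thesis by (simp add: max_def)
    qed
    then show ?thesis by (auto simp: sup_max max_def ennreal_le_iff)
  qed
  show ?case
  proof (intro exI[of _ "l1 @ l2"] allI)
    fix z
    have [simp]: "sup 0 x = x" for x :: ennreal by (simp add: bot_ennreal[symmetric])
    show "step (l1 @ l2) z = indicator (E j) z *
     sup (ennreal \<bar>of_rat r\<bar>) (SUP (q, i)\<in>set (p # ps). ennreal \<bar>of_rat q\<bar> * indicator (E i) z)"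
      unfolding step_simps l1 l2 max by (auto simp: j p indicator_def sup.assoc)
  qed
qed

text \<open>By continuity, \<open>c\<close> is the supremum of the countably many multiples of indicators of members of the
  algebra that lie below it. Finite maxima of these are step functions increasing to \<open>c\<close>, and
  monotone convergence applies.\<close>

lemma nn_integral_le_of_steps:
  assumes c: "continuous_on UNIV c" and sets: "sets \<pi> = sets borel"
    and le: "\<And>l. (\<And>z. step l z \<le> c z) \<Longrightarrow> (\<integral>\<^sup>+z. step l z \<partial>\<pi>) \<le> s"
  shows "(\<integral>\<^sup>+z. c z \<partial>\<pi>) \<le> s"
proof -
  define rect where "rect = (\<lambda>(q, i) z. ennreal \<bar>of_rat q\<bar> * indicator (E i) z)"
  define P where "P = {p. \<forall>z. rect p z \<le> c z}"
  have "(0, 0) \<in> P" by (simp add: P_def rect_def)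
  then have P: "countable P" "P \<noteq> {}" by auto
  define p where "p = from_nat_into P"
  have range_p: "range p = P" using P by (simp add: p_def)
  define C where "C n z = (SUP x\<in>set (map p [0..<n]). rect x z)" for n z
  obtain u where u: "E u = UNIV" using E.top by (metis rangeE)
  have step_C: "\<exists>l. step l = C n" for n
  proof -
    obtain l where "\<And>z. step l z = indicator (E u) z * sup (ennreal \<bar>of_rat 0\<bar>)
        (SUP (q, i)\<in>set (map p [0..<n]). ennreal \<bar>of_rat q\<bar> * indicator (E i) z)"
      using ex_step_eq_Sup[of u 0 "map p [0..<n]"] by blast
    then have "step l = C n"
      unfolding C_def rect_def by (auto simp: u bot_ennreal[symmetric] case_prod_unfold)
    then show ?thesis ..
  qed
  have C_le: "C n z \<le> c z" for n z
    unfolding C_def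
  proof (rule SUP_least)
    fix x assume "x \<in> set (map p [0..<n])"
    then have "x \<in> P" using range_p by auto
    then show "rect x z \<le> c z" unfolding P_def by blast
  qed
  have SUP_C: "(SUP n. C n z) = c z" for z
  proof (rule antisym)
    show "(SUP n. C n z) \<le> c z" by (intro SUP_least C_le)
    show "c z \<le> (SUP n. C n z)"
    proof (rule ccontr)
      assume "\<not> ?thesis"
      then have lt: "(SUP n. C n z) < c z" by simp
      then obtain x where x: "(SUP n. C n z) < x" "x < c z" using dense by blast
      then obtain y where y: "x < y" "y < c z" using dense by blast
      obtain r where r: "x = ennreal r" "0 \<le> r" using y(1) by (cases x) auto
      obtain r' where r': "y = ennreal r'" "0 \<le> r'" using y(2) by (cases y) auto
      have "r < r'" using y(1) r r' by (simp add: ennreal_less_iff)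
      then obtain q where q: "r < of_rat q" "of_rat q < r'" using of_rat_dense by blast
      have q0: "\<bar>of_rat q :: real\<bar> = of_rat q" using q(1) r(2) by (intro abs_of_nonneg) linarith
      have qc: "ennreal (of_rat q) < c z"
      proof -
        have "ennreal (of_rat q) < y" unfolding r'(1) using q r(2) by (intro ennreal_lessI) linarith+
        then show ?thesis using y(2) by (rule less_trans)
      qed
      have "open {z. ennreal (of_rat q) < c z}" by (intro open_Collect_less c continuous_on_const)
      then obtain i where i: "z \<in> E i" "E i \<subseteq> {z. ennreal (of_rat q) < c z}"
        using E_topological_basis[of "{z. ennreal (of_rat q) < c z}" z] qc by auto
      have "(q, i) \<in> P" using i(2) q0 by (force simp: P_def rect_def indicator_def intro: less_imp_le)
      then obtain n where n: "p n = (q, i)" using range_p by (metis rangeE)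
      have "ennreal (of_rat q) = rect (p n) z" using i(1) q0 by (simp add: n rect_def)
      also have "\<dots> \<le> C (Suc n) z" unfolding C_def by (intro SUP_upper) auto
      also have "\<dots> \<le> (SUP n. C n z)" by (intro SUP_upper) auto
      also have "\<dots> < x" by (rule x)
      finally have "ennreal (of_rat q) < ennreal r" unfolding r(1) .
      then show False using q(1) ennreal_leI[of r "of_rat q"] by simp
    qed
  qed
  have "incseq C"
    by (auto simp: incseq_def le_fun_def C_def intro!: SUP_subset_mono)
  moreover have "C n \<in> borel_measurable \<pi>" for n
    using step_C[of n] step_measurable measurable_cong_sets[OF sets refl] by metis
  ultimately have "(\<integral>\<^sup>+z. (SUP n. C n z) \<partial>\<pi>) = (SUP n. \<integral>\<^sup>+z. C n z \<partial>\<pi>)"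
    by (intro nn_integral_monotone_convergence_SUP)
  also have "\<dots> \<le> s"
  proof (rule SUP_least)
    fix n
    obtain l where l: "step l = C n" using step_C by blast
    show "(\<integral>\<^sup>+z. C n z \<partial>\<pi>) \<le> s" using le[of l] C_le by (simp add: l)
  qed
  finally show ?thesis by (simp add: SUP_C)
qed

text \<open>A step function is constant on each of finitely many level sets, so comparison with a continuous
  function needs to be made only on a dense countable subset of each of them. Through this,
  the event that a step function lies below \<open>c \<omega>\<close> is measurable in \<open>\<omega>\<close>.\<close>

lemma countable_test_set:
  obtains D where "countable D"
    "\<And>h. continuous_on UNIV h \<Longrightarrow> (\<forall>z. step l z \<le> h z) \<longleftrightarrow> (\<forall>z\<in>D. step l z \<le> h z)"
proof -
  have "\<forall>y. \<exists>D. countable D \<and> D \<subseteq> step l -` {y} \<and> step l -` {y} \<subseteq> closure D"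
    using countable_dense_subset by metis
  then obtain D where D: "\<And>y. countable (D y)" "\<And>y. D y \<subseteq> step l -` {y}"
      "\<And>y. step l -` {y} \<subseteq> closure (D y)"
    by metis
  show ?thesis
  proof (rule that[of "\<Union>y\<in>range (step l). D y"])
    show "countable (\<Union>y\<in>range (step l). D y)"
      using finite_range_step[of l] D(1) by (intro countable_UN) (auto intro: countable_finite)
    fix h :: "'a \<times> 'b \<Rightarrow> ennreal" assume h: "continuous_on UNIV h"
    have "step l z \<le> h z" if *: "\<forall>z\<in>(\<Union>y\<in>range (step l). D y). step l z \<le> h z" for z
    proof -
      let ?y = "step l z"
      have "D ?y \<subseteq> {x. ?y \<le> h x}"
      proof
        fix x assume x: "x \<in> D ?y"
        then have "step l x = ?y" using D(2)[of ?y] by auto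
        moreover have "step l x \<le> h x" using * x by blast
        ultimately show "x \<in> {x. ?y \<le> h x}" by simp
      qed
      then have "closure (D ?y) \<subseteq> {x. ?y \<le> h x}"
        by (intro closure_minimal closed_Collect_le h continuous_on_const)
      moreover have "z \<in> closure (D ?y)" using D(3)[of ?y] by auto
      ultimately show ?thesis by auto
    qed
    then show "(\<forall>z. step l z \<le> h z) \<longleftrightarrow> (\<forall>z\<in>(\<Union>y\<in>range (step l). D y). step l z \<le> h z)"
      by blast
  qed
qed

end

section \<open>Couplings of bounded cost as a compact set\<close>

lemma pair_measure_coupling:
  fixes \<mu> :: "'a::polish_space measure" and \<nu> :: "'b::polish_space measure"
  assumes \<mu>: "prob_space \<mu>" "sets \<mu> = sets borel" and \<nu>: "prob_space \<nu>" "sets \<nu> = sets borel"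
  shows "\<mu> \<Otimes>\<^sub>M \<nu> \<in> couplings \<mu> \<nu>"
proof -
  interpret \<mu>: prob_space \<mu> by (rule \<mu>)
  interpret \<nu>: prob_space \<nu> by (rule \<nu>)
  interpret pair_prob_space \<mu> \<nu> ..
  have sp: "space \<mu> = UNIV" "space \<nu> = UNIV"
    using sets_eq_imp_space_eq[OF \<mu>(2)] sets_eq_imp_space_eq[OF \<nu>(2)] by auto
  have sets: "sets (\<mu> \<Otimes>\<^sub>M \<nu>) = sets borel"
    unfolding sets_pair_measure_cong[OF \<mu>(2) \<nu>(2)] borel_prod ..
  have [measurable]: "fst \<in> measurable (\<mu> \<Otimes>\<^sub>M \<nu>) borel" "snd \<in> measurable (\<mu> \<Otimes>\<^sub>M \<nu>) borel"
    using measurable_fst[of \<mu> \<nu>] measurable_snd[of \<mu> \<nu>]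
      measurable_cong_sets[OF refl \<mu>(2)] measurable_cong_sets[OF refl \<nu>(2)] by blast+
  have "distr (\<mu> \<Otimes>\<^sub>M \<nu>) borel fst = \<mu>"
  proof (rule measure_eqI)
    fix A assume "A \<in> sets (distr (\<mu> \<Otimes>\<^sub>M \<nu>) borel fst)"
    then have A: "A \<in> sets borel" by simp
    have "fst -` A \<inter> space (\<mu> \<Otimes>\<^sub>M \<nu>) = A \<times> UNIV" by (auto simp: space_pair_measure sp)
    then show "emeasure (distr (\<mu> \<Otimes>\<^sub>M \<nu>) borel fst) A = emeasure \<mu> A"
      using A \<nu>.emeasure_space_1 \<mu>(2) sp sets.top[of \<nu>]
      by (simp add: emeasure_distr \<nu>.emeasure_pair_measure_Times)
  qed (simp add: \<mu>)
  moreover have "distr (\<mu> \<Otimes>\<^sub>M \<nu>) borel snd = \<nu>"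
  proof (rule measure_eqI)
    fix A assume "A \<in> sets (distr (\<mu> \<Otimes>\<^sub>M \<nu>) borel snd)"
    then have A: "A \<in> sets borel" by simp
    have "snd -` A \<inter> space (\<mu> \<Otimes>\<^sub>M \<nu>) = UNIV \<times> A" by (auto simp: space_pair_measure sp)
    then show "emeasure (distr (\<mu> \<Otimes>\<^sub>M \<nu>) borel snd) A = emeasure \<nu> A"
      using A \<mu>.emeasure_space_1 \<nu>(2) sp sets.top[of \<mu>]
      by (simp add: emeasure_distr \<nu>.emeasure_pair_measure_Times)
  qed (simp add: \<nu>)
  ultimately show ?thesis
    using sets prob_space_axioms by (simp add: couplings_def)
qed

lemma compact_unit_cube: "compact {m :: nat \<Rightarrow> real. \<forall>i. 0 \<le> m i \<and> m i \<le> 1}"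
proof -
  have "{m :: nat \<Rightarrow> real. \<forall>i. 0 \<le> m i \<and> m i \<le> 1} = (\<Pi>\<^sub>E i\<in>UNIV. {0..1})"
    by (auto simp: PiE_def extensional_def)
  moreover have "compactin (product_topology (\<lambda>i::nat. euclidean :: real topology) UNIV) (\<Pi>\<^sub>E i\<in>UNIV. {0..1})"
    by (subst compactin_PiE) auto
  ultimately show ?thesis
    by (simp add: euclidean_product_topology)
qed

context cylinder_algebra
begin

text \<open>The value sequences of couplings with cost at most \<open>s\<close>, by the two lemmas that follow.\<close>

definition feasible ::
  "('a \<times> 'b \<Rightarrow> ennreal) \<Rightarrow> 'a measure \<Rightarrow> 'b measure \<Rightarrow> ennreal \<Rightarrow> (nat \<Rightarrow> real) \<Rightarrow> bool" where
  "feasible c \<mu> \<nu> s m \<longleftrightarrow> coupling_values \<mu> \<nu> m \<and>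
     (\<forall>l. (\<forall>z. step l z \<le> c z) \<longrightarrow> ennreal (step_value l m) \<le> s)"

lemma feasible_of_coupling:
  assumes \<pi>: "\<pi> \<in> couplings \<mu> \<nu>" and le: "(\<integral>\<^sup>+z. c z \<partial>\<pi>) \<le> s"
  shows "feasible c \<mu> \<nu> s (\<lambda>i. measure \<pi> (E i))"
  unfolding feasible_def
proof (intro conjI allI impI)
  interpret prob_space \<pi> using \<pi> by (simp add: couplings_def)
  show "coupling_values \<mu> \<nu> (\<lambda>i. measure \<pi> (E i))" by (rule coupling_values_of_coupling[OF \<pi>])
  fix l assume l: "\<forall>z. step l z \<le> c z"
  have "ennreal (step_value l (\<lambda>i. measure \<pi> (E i))) = (\<integral>\<^sup>+z. step l z \<partial>\<pi>)"
    using \<pi> by (intro nn_integral_step[symmetric]) (simp_all add: couplings_def emeasure_eq_measure)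
  also have "\<dots> \<le> (\<integral>\<^sup>+z. c z \<partial>\<pi>)" using l by (intro nn_integral_mono) blast
  finally show "ennreal (step_value l (\<lambda>i. measure \<pi> (E i))) \<le> s" using le by simp
qed

lemma coupling_of_feasible:
  assumes \<mu>: "prob_space \<mu>" "sets \<mu> = sets borel" and \<nu>: "prob_space \<nu>" "sets \<nu> = sets borel"
    and c: "continuous_on UNIV c" and m: "feasible c \<mu> \<nu> s m"
  obtains \<pi> where "\<pi> \<in> couplings \<mu> \<nu>" "\<And>i. emeasure \<pi> (E i) = ennreal (m i)" "(\<integral>\<^sup>+z. c z \<partial>\<pi>) \<le> s"
proof -
  have cv: "coupling_values \<mu> \<nu> m" using m by (simp add: feasible_def)
  then have m0: "0 \<le> m i" for i by (simp add: coupling_values_def)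
  obtain \<pi> where \<pi>: "\<pi> \<in> couplings \<mu> \<nu>" "\<And>i. emeasure \<pi> (E i) = ennreal (m i)"
    using coupling_of_coupling_values[OF \<mu> \<nu> cv] by blast
  have sets: "sets \<pi> = sets borel" using \<pi>(1) by (simp add: couplings_def)
  have "(\<integral>\<^sup>+z. c z \<partial>\<pi>) \<le> s"
  proof (rule nn_integral_le_of_steps[OF c sets])
    fix l assume "\<And>z. step l z \<le> c z"
    then show "(\<integral>\<^sup>+z. step l z \<partial>\<pi>) \<le> s"
      using m nn_integral_step[OF sets \<pi>(2) m0] by (simp add: feasible_def)
  qed
  with \<pi> show ?thesis by (rule that)
qed

definition additive_values :: "(nat \<Rightarrow> real) set" where
  "additive_values = {m. \<forall>i. 0 \<le> m i \<and> m i \<le> 1} \<inter>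
     {m. \<forall>i j k. E i \<inter> E j = {} \<longrightarrow> E k = E i \<union> E j \<longrightarrow> m k = m i + m j}"

lemma compact_additive_values: "compact additive_values"
  unfolding additive_values_def
proof (rule compact_Int_closed[OF compact_unit_cube])
  have "closed {m :: nat \<Rightarrow> real. m k = m i + m j}" for i j k
    by (intro closed_Collect_eq continuous_on_add continuous_on_product_coordinates)
  then show "closed {m :: nat \<Rightarrow> real. \<forall>i j k. E i \<inter> E j = {} \<longrightarrow> E k = E i \<union> E j \<longrightarrow> m k = m i + m j}"
    by (intro closed_Collect_all closed_Collect_imp open_Collect_const)
qed

text \<open>The conditions of \<^const>\<open>feasible\<close> that depend on the data, as inequalities \<open>constraint \<dots> j m \<le> 0\<close> with
  countably many indices \<open>j\<close>. If \<open>E i\<close> is a cylinder over \<open>A\<close>, then \<open>A\<close> is recovered as the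
  projection of \<open>E i\<close>. The value \<open>0\<close> switches a condition off; in particular, an infinite cost bound
  imposes nothing.\<close>

definition constraint ::
  "('a \<times> 'b \<Rightarrow> ennreal) \<Rightarrow> 'a measure \<Rightarrow> 'b measure \<Rightarrow> ennreal \<Rightarrow>
     nat + nat + (rat \<times> nat) list \<Rightarrow> (nat \<Rightarrow> real) \<Rightarrow> real" where
  "constraint c \<mu> \<nu> s j m = (case j of
       Inl i \<Rightarrow> if fst ` E i \<in> sets borel \<and> E i = fst -` fst ` E i
         then \<bar>m i - measure \<mu> (fst ` E i)\<bar> else 0
     | Inr (Inl i) \<Rightarrow> if snd ` E i \<in> sets borel \<and> E i = snd -` snd ` E i
         then \<bar>m i - measure \<nu> (snd ` E i)\<bar> else 0
     | Inr (Inr l) \<Rightarrow> if (\<forall>z. step l z \<le> c z) \<and> s \<noteq> \<infinity> then step_value l m - enn2real s else 0)"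

lemma constraint_cases:
  fixes j :: "nat + nat + (rat \<times> nat) list"
  obtains (fst) i where "j = Inl i" | (snd) i where "j = Inr (Inl i)" | (step) l where "j = Inr (Inr l)"
proof (cases j)
  case (Inr k)
  then show ?thesis using that by (cases k) auto
qed (rule that)

lemma feasible_iff_constraint:
  "feasible c \<mu> \<nu> s m \<longleftrightarrow> m \<in> additive_values \<and> (\<forall>j. constraint c \<mu> \<nu> s j m \<le> 0)"
proof -
  have [simp]: "(fst :: 'a \<times> 'b \<Rightarrow> 'a) ` fst -` A = A" for A by force
  have [simp]: "(snd :: 'a \<times> 'b \<Rightarrow> 'b) ` snd -` B = B" for B by force
  have 1: "(\<forall>i. \<forall>A\<in>sets borel. E i = fst -` A \<longrightarrow> m i = measure \<mu> A) \<longleftrightarrow>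
      (\<forall>i. constraint c \<mu> \<nu> s (Inl i) m \<le> 0)"
    by (auto simp: constraint_def)
  have 2: "(\<forall>i. \<forall>A\<in>sets borel. E i = snd -` A \<longrightarrow> m i = measure \<nu> A) \<longleftrightarrow>
      (\<forall>i. constraint c \<mu> \<nu> s (Inr (Inl i)) m \<le> 0)"
    by (auto simp: constraint_def)
  have 3: "(\<forall>l. (\<forall>z. step l z \<le> c z) \<longrightarrow> ennreal (step_value l m) \<le> s) \<longleftrightarrow>
      (\<forall>l. constraint c \<mu> \<nu> s (Inr (Inr l)) m \<le> 0)"
    by (cases s) (auto simp: constraint_def ennreal_le_iff)
  have all: "(\<forall>j. Q j) \<longleftrightarrow> (\<forall>i. Q (Inl i)) \<and> (\<forall>i. Q (Inr (Inl i))) \<and> (\<forall>l. Q (Inr (Inr l)))"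
    for Q :: "nat + nat + (rat \<times> nat) list \<Rightarrow> bool"
    by (metis sum.exhaust)
  show ?thesis
    unfolding all feasible_def coupling_values_def additive_values_def 1 2 3 by auto
qed

lemma continuous_on_step_value: "continuous_on S (step_value l)"
proof (induction l)
  case Nil
  then show ?case by (simp add: step_value_simps[abs_def])
next
  case (Cons p l)
  obtain q i where p: "p = (q, i)" by (cases p)
  have "step_value (p # l) = (\<lambda>m. \<bar>of_rat q\<bar> * m i + step_value l m)"
    unfolding p by (rule ext) (rule step_value_simps)
  moreover have "continuous_on S (\<lambda>m :: nat \<Rightarrow> real. m i)"
    by (rule continuous_on_subset[OF continuous_on_product_coordinates]) simp
  ultimately show ?case
    using Cons by (simp add: continuous_on_add continuous_on_mult_left)
qed

lemma continuous_on_constraint: "continuous_on S (constraint c \<mu> \<nu> s j)"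
proof -
  have coord: "continuous_on S (\<lambda>m. m i)" for i :: nat
    by (rule continuous_on_subset[OF continuous_on_product_coordinates]) simp
  have if_const: "continuous_on S (\<lambda>m. if b then f m else 0)" if "continuous_on S f"
    for b and f :: "(nat \<Rightarrow> real) \<Rightarrow> real"
    using that by (cases b) auto
  show ?thesis
  proof (cases j rule: constraint_cases)
    case (fst i)
    show ?thesis unfolding constraint_def[abs_def] fst sum.case
      by (intro if_const continuous_on_rabs continuous_on_diff coord continuous_on_const)
  next
    case (snd i)
    show ?thesis unfolding constraint_def[abs_def] snd sum.case
      by (intro if_const continuous_on_rabs continuous_on_diff coord continuous_on_const)
  next
    case (step l)
    show ?thesis unfolding constraint_def[abs_def] step sum.case
      by (intro if_const continuous_on_diff continuous_on_step_value continuous_on_const)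
  qed
qed

lemma compact_feasible: "compact {m. feasible c \<mu> \<nu> s m}"
proof -
  have "{m. feasible c \<mu> \<nu> s m} = additive_values \<inter> (\<Inter>j. {m. constraint c \<mu> \<nu> s j m \<le> 0})"
    by (auto simp: feasible_iff_constraint)
  also have "compact \<dots>"
    by (intro compact_Int_closed compact_additive_values closed_INT ballI closed_Collect_le
        continuous_on_constraint continuous_on_const)
  finally show ?thesis .
qed

lemma feasible_mono: "feasible c \<mu> \<nu> s m \<Longrightarrow> s \<le> t \<Longrightarrow> feasible c \<mu> \<nu> t m"
  by (auto simp: feasible_def intro: order_trans)

lemma constraint_relax:
  assumes "0 \<le> v" "0 \<le> e" "constraint c \<mu> \<nu> (ennreal (v + e)) j m \<le> 0"
  shows "constraint c \<mu> \<nu> (ennreal v) j m \<le> e"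
  using assms by (cases j rule: constraint_cases)
    (auto simp: constraint_def simp del: ennreal_plus split_paired_All split: if_splits)

text \<open>The infimum is attained: if it is a finite \<open>v\<close>, couplings of cost at most \<open>v + 1 / Suc n\<close> are approximate solutions of the
  constraints for the bound \<open>v\<close>, and compactness yields an exact one.\<close>

lemma ex_feasible_C_deter:
  assumes "\<pi>0 \<in> couplings \<mu> \<nu>"
  shows "\<exists>m. feasible (\<lambda>(x, y). c x y) \<mu> \<nu> (C_deter c \<mu> \<nu>) m"
proof (cases "C_deter c \<mu> \<nu> = \<infinity>")
  case True
  then show ?thesis using feasible_of_coupling[OF assms, of "\<lambda>(x, y). c x y" \<infinity>] by (metis infinity_ennreal_def top_greatest)
next
  case False
  let ?v = "C_deter c \<mu> \<nu>" and ?c = "\<lambda>(x, y). c x y"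
  obtain v where v: "?v = ennreal v" "0 \<le> v" using False by (cases ?v) auto
  have "\<exists>m\<in>additive_values. \<forall>j. constraint ?c \<mu> \<nu> ?v j m \<le> 0"
  proof (rule compact_satisfies_all[OF compact_additive_values continuous_on_constraint])
    fix n
    have "?v < ennreal (v + 1 / Suc n)" using v by (simp add: ennreal_less_iff)
    then obtain \<pi> where \<pi>: "\<pi> \<in> couplings \<mu> \<nu>" "(\<integral>\<^sup>+z. ?c z \<partial>\<pi>) < ennreal (v + 1 / Suc n)"
      unfolding C_deter_def INF_less_iff by blast
    let ?m = "\<lambda>i. measure \<pi> (E i)"
    have f: "?m \<in> additive_values" "\<And>j. constraint ?c \<mu> \<nu> (ennreal (v + 1 / Suc n)) j ?m \<le> 0"
      using feasible_of_coupling[OF \<pi>(1) less_imp_le[OF \<pi>(2)]] by (auto simp: feasible_iff_constraint)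
    have "constraint ?c \<mu> \<nu> ?v j ?m \<le> 1 / Suc n" for j
      unfolding v(1) by (rule constraint_relax[OF v(2) _ f(2)]) simp
    with f(1) show "\<exists>m\<in>additive_values. \<forall>j. to_nat j \<le> n \<longrightarrow> constraint ?c \<mu> \<nu> ?v j m \<le> 1 / Suc n"
      by blast
  qed
  then show ?thesis by (auto simp: feasible_iff_constraint)
qed

text \<open>Each constraint is measurable in \<open>\<omega>\<close>: the first two kinds because \<open>\<mu>\<close> and \<open>\<nu>\<close> are kernels, the third
  because the bound is measurable and the condition is switched on by a measurable event.\<close>

lemma sets_Collect_ex_feasible:
  fixes M :: "'w measure"
  assumes \<mu>: "\<mu> \<in> M \<rightarrow>\<^sub>M prob_algebra borel" and \<nu>: "\<nu> \<in> M \<rightarrow>\<^sub>M prob_algebra borel"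
    and c: "\<And>\<omega>. \<omega> \<in> space M \<Longrightarrow> continuous_on UNIV (c \<omega>)" "\<And>z. (\<lambda>\<omega>. c \<omega> z) \<in> borel_measurable M"
    and s: "s \<in> borel_measurable M" and C: "closed C"
  shows "{\<omega>\<in>space M. {m. feasible (c \<omega>) (\<mu> \<omega>) (\<nu> \<omega>) (s \<omega>) m} \<inter> C \<noteq> {}} \<in> sets M"
proof -
  note [measurable] = s c(2)
  have meas: "(\<lambda>\<omega>. constraint (c \<omega>) (\<mu> \<omega>) (\<nu> \<omega>) (s \<omega>) j m) \<in> borel_measurable M" for j m
  proof -
    show ?thesis
    proof (cases j rule: constraint_cases)
      case (fst i)
      have "(\<lambda>\<omega>. measure (\<mu> \<omega>) (fst ` E i)) \<in> borel_measurable M" if "fst ` E i \<in> sets borel"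
        unfolding measure_def
        by (rule measurable_compose[OF measurable_emeasure_kernel[OF measurable_prob_algebraD[OF \<mu>] that]])
           measurable
      then show ?thesis by (cases "fst ` E i \<in> sets borel") (simp_all add: constraint_def fst)
    next
      case (snd i)
      have "(\<lambda>\<omega>. measure (\<nu> \<omega>) (snd ` E i)) \<in> borel_measurable M" if "snd ` E i \<in> sets borel"
        unfolding measure_def
        by (rule measurable_compose[OF measurable_emeasure_kernel[OF measurable_prob_algebraD[OF \<nu>] that]])
           measurable
      then show ?thesis by (cases "snd ` E i \<in> sets borel") (simp_all add: constraint_def snd)
    next
      case (step l)
      obtain D where D: "countable D"
        "\<And>h. continuous_on UNIV h \<Longrightarrow> (\<forall>z. step l z \<le> h z) \<longleftrightarrow> (\<forall>z\<in>D. step l z \<le> h z)"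
        using countable_test_set by blast
      have "{\<omega>\<in>space M. \<forall>z. step l z \<le> c \<omega> z} = {\<omega>\<in>space M. \<forall>z\<in>D. step l z \<le> c \<omega> z}"
        using D(2) c(1) by blast
      also have "\<dots> \<in> sets M"
        by (rule sets.sets_Collect_countable_All'[OF _ D(1)]) measurable
      finally have [measurable]: "Measurable.pred M (\<lambda>\<omega>. \<forall>z. step l z \<le> c \<omega> z)"
        by (simp add: pred_def)
      show ?thesis unfolding constraint_def step sum.case by measurable
    qed
  qed
  have "{m. feasible (c \<omega>) (\<mu> \<omega>) (\<nu> \<omega>) (s \<omega>) m} \<inter> C \<noteq> {} \<longleftrightarrow>
      (\<exists>m\<in>additive_values \<inter> C. \<forall>j. constraint (c \<omega>) (\<mu> \<omega>) (\<nu> \<omega>) (s \<omega>) j m \<le> 0)" for \<omega>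
    by (auto simp: feasible_iff_constraint)
  then show ?thesis
    using sets_Collect_ex_compact[OF compact_Int_closed[OF compact_additive_values C], of M
        "\<lambda>j \<omega> m. constraint (c \<omega>) (\<mu> \<omega>) (\<nu> \<omega>) (s \<omega>) j m"] meas continuous_on_constraint
    by simp
qed

lemma C_deter_le_iff:
  assumes \<mu>: "prob_space \<mu>" "sets \<mu> = sets borel" and \<nu>: "prob_space \<nu>" "sets \<nu> = sets borel"
    and c: "continuous_on UNIV (\<lambda>(x, y). c x y)"
  shows "C_deter c \<mu> \<nu> \<le> s \<longleftrightarrow> (\<exists>m. feasible (\<lambda>(x, y). c x y) \<mu> \<nu> s m)"
proof
  assume "C_deter c \<mu> \<nu> \<le> s"
  then show "\<exists>m. feasible (\<lambda>(x, y). c x y) \<mu> \<nu> s m"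
    using ex_feasible_C_deter[OF pair_measure_coupling[OF \<mu> \<nu>], of c] feasible_mono by blast
next
  assume "\<exists>m. feasible (\<lambda>(x, y). c x y) \<mu> \<nu> s m"
  then obtain m where m: "feasible (\<lambda>(x, y). c x y) \<mu> \<nu> s m" ..
  obtain \<pi> where "\<pi> \<in> couplings \<mu> \<nu>" "(\<integral>\<^sup>+(x, y). c x y \<partial>\<pi>) \<le> s"
    by (rule coupling_of_feasible[OF \<mu> \<nu> c m])
  then show "C_deter c \<mu> \<nu> \<le> s"
    unfolding C_deter_def by (rule INF_lower2)
qed

lemma kernel_measurable_of_values:
  assumes prob: "\<And>\<omega>. \<omega> \<in> space M \<Longrightarrow> prob_space (\<pi> \<omega>)"
    and sets: "\<And>\<omega>. \<omega> \<in> space M \<Longrightarrow> sets (\<pi> \<omega>) = sets borel"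
    and meas: "\<And>i. (\<lambda>\<omega>. emeasure (\<pi> \<omega>) (E i)) \<in> borel_measurable M"
  shows "prob_kernel M \<pi>"
  unfolding prob_kernel_def
proof (rule measurable_prob_algebra_generated[OF sigma_sets_E[symmetric] _ _ prob sets])
  show "Int_stable (range E)" using E.Int by (auto simp: Int_stable_def)
  show "(\<lambda>\<omega>. emeasure (\<pi> \<omega>) A) \<in> borel_measurable M" if "A \<in> range E" for A
    using that meas by auto
qed auto

end

section \<open>Measurable optimal couplings and the stochastic problem\<close>

text \<open>The selection is made among the value sequences that are feasible for the optimal cost, and
  afterwards each selected sequence is extended to a coupling. The extensions are chosen
  separately for each \<open>\<omega>\<close>: measurability of the resulting kernel depends only on its values on the
  algebra, which are the selected ones.\<close>

lemma measurable_optimal_kernel: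
  fixes \<mu> :: "'w \<Rightarrow> 'a::polish_space measure" and \<nu> :: "'w \<Rightarrow> 'b::polish_space measure"
  assumes \<mu>: "prob_kernel M \<mu>" and \<nu>: "prob_kernel M \<nu>"
    and c_cont: "\<And>\<omega>. \<omega> \<in> space M \<Longrightarrow> continuous_on UNIV (\<lambda>(x, y). c \<omega> x y)"
    and c_meas: "\<And>x y. (\<lambda>\<omega>. c \<omega> x y) \<in> borel_measurable M"
  shows "(\<lambda>\<omega>. C_deter (c \<omega>) (\<mu> \<omega>) (\<nu> \<omega>)) \<in> borel_measurable M"
    and "\<exists>\<pi>\<in>kernel_couplings M \<mu> \<nu>. \<forall>\<omega>\<in>space M.
           (\<integral>\<^sup>+ (x, y). c \<omega> x y \<partial>\<pi> \<omega>) = C_deter (c \<omega>) (\<mu> \<omega>) (\<nu> \<omega>)"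
proof -
  obtain E :: "nat \<Rightarrow> ('a \<times> 'b) set" and BX BY where "cylinder_algebra E BX BY"
    using ex_cylinder_algebra by blast
  then interpret cylinder_algebra E BX BY .
  let ?c = "\<lambda>\<omega> (x, y). c \<omega> x y"
  define v where "v \<omega> = C_deter (c \<omega>) (\<mu> \<omega>) (\<nu> \<omega>)" for \<omega>
  have \<mu>': "prob_space (\<mu> \<omega>)" "sets (\<mu> \<omega>) = sets borel" if "\<omega> \<in> space M" for \<omega>
    using \<mu> that by (auto simp: prob_kernel_iff)
  have \<nu>': "prob_space (\<nu> \<omega>)" "sets (\<nu> \<omega>) = sets borel" if "\<omega> \<in> space M" for \<omega>
    using \<nu> that by (auto simp: prob_kernel_iff)
  have v_le_iff: "v \<omega> \<le> s \<longleftrightarrow> (\<exists>m. feasible (?c \<omega>) (\<mu> \<omega>) (\<nu> \<omega>) s m)" if "\<omega> \<in> space M" for \<omega> s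
    unfolding v_def by (rule C_deter_le_iff[OF \<mu>' \<nu>' c_cont]) (rule that)+
  have hit: "{\<omega>\<in>space M. {m. feasible (?c \<omega>) (\<mu> \<omega>) (\<nu> \<omega>) (s \<omega>) m} \<inter> C \<noteq> {}} \<in> sets M"
    if "s \<in> borel_measurable M" "closed C" for s C
  proof (rule sets_Collect_ex_feasible[OF _ _ c_cont _ that])
    show "(\<lambda>\<omega>. ?c \<omega> z) \<in> borel_measurable M" for z
      using c_meas[of "fst z" "snd z"] by (simp add: case_prod_unfold)
  qed (use \<mu> \<nu> in \<open>auto simp: prob_kernel_def\<close>)
  have v_meas: "v \<in> borel_measurable M"
  proof (rule borel_measurableI_le)
    fix s
    have "{\<omega>\<in>space M. v \<omega> \<le> s} = {\<omega>\<in>space M. {m. feasible (?c \<omega>) (\<mu> \<omega>) (\<nu> \<omega>) s m} \<inter> UNIV \<noteq> {}}"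
      using v_le_iff by auto
    then show "{\<omega>\<in>space M. v \<omega> \<le> s} \<in> sets M" using hit[of "\<lambda>_. s" UNIV] by simp
  qed
  then show "(\<lambda>\<omega>. C_deter (c \<omega>) (\<mu> \<omega>) (\<nu> \<omega>)) \<in> borel_measurable M" by (simp add: v_def[abs_def])
  have "hit_measurable M (\<lambda>\<omega>. {m. feasible (?c \<omega>) (\<mu> \<omega>) (\<nu> \<omega>) (v \<omega>) m})"
    unfolding hit_measurable_def
  proof (intro conjI ballI allI impI)
    show "compact {m. feasible (?c \<omega>) (\<mu> \<omega>) (\<nu> \<omega>) (v \<omega>) m}" for \<omega>
      by (rule compact_feasible)
    show "{m. feasible (?c \<omega>) (\<mu> \<omega>) (\<nu> \<omega>) (v \<omega>) m} \<noteq> {}" if "\<omega> \<in> space M" for \<omega>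
      using v_le_iff[OF that, of "v \<omega>"] by auto
  qed (rule hit[OF v_meas])
  then obtain s where s: "\<And>\<omega>. \<omega> \<in> space M \<Longrightarrow> s \<omega> \<in> {m. feasible (?c \<omega>) (\<mu> \<omega>) (\<nu> \<omega>) (v \<omega>) m}"
      and s_meas: "\<And>i. (\<lambda>\<omega>. s \<omega> i) \<in> borel_measurable M"
    by (rule hit_measurable_selection[of M _ "\<lambda>i m. m i"]) auto
  have "\<exists>\<pi>. \<pi> \<in> couplings (\<mu> \<omega>) (\<nu> \<omega>) \<and> (\<forall>i. emeasure \<pi> (E i) = ennreal (s \<omega> i)) \<and>
      (\<integral>\<^sup>+z. ?c \<omega> z \<partial>\<pi>) \<le> v \<omega>" if \<omega>: "\<omega> \<in> space M" for \<omega>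
  proof -
    have m: "feasible (?c \<omega>) (\<mu> \<omega>) (\<nu> \<omega>) (v \<omega>) (s \<omega>)" using s[OF \<omega>] by simp
    show ?thesis
      by (rule coupling_of_feasible[OF \<mu>'[OF \<omega>] \<nu>'[OF \<omega>] c_cont[OF \<omega>] m]) blast
  qed
  then have "\<exists>\<pi>. \<forall>\<omega>\<in>space M. \<pi> \<omega> \<in> couplings (\<mu> \<omega>) (\<nu> \<omega>) \<and>
      (\<forall>i. emeasure (\<pi> \<omega>) (E i) = ennreal (s \<omega> i)) \<and> (\<integral>\<^sup>+z. ?c \<omega> z \<partial>\<pi> \<omega>) \<le> v \<omega>"
    by (intro bchoice ballI)
  then obtain \<pi> where \<pi>: "\<And>\<omega>. \<omega> \<in> space M \<Longrightarrow> \<pi> \<omega> \<in> couplings (\<mu> \<omega>) (\<nu> \<omega>)"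
      and \<pi>_E: "\<And>\<omega> i. \<omega> \<in> space M \<Longrightarrow> emeasure (\<pi> \<omega>) (E i) = ennreal (s \<omega> i)"
      and \<pi>_le: "\<And>\<omega>. \<omega> \<in> space M \<Longrightarrow> (\<integral>\<^sup>+z. ?c \<omega> z \<partial>\<pi> \<omega>) \<le> v \<omega>"
    by auto
  have "prob_kernel M \<pi>"
  proof (rule kernel_measurable_of_values)
    show "(\<lambda>\<omega>. emeasure (\<pi> \<omega>) (E i)) \<in> borel_measurable M" for i
      using s_meas[of i] by (simp add: \<pi>_E cong: measurable_cong)
  qed (use \<pi> in \<open>auto simp: couplings_def\<close>)
  then have "\<pi> \<in> kernel_couplings M \<mu> \<nu>"
    using \<pi> by (auto simp: kernel_couplings_def couplings_def)
  moreover have "(\<integral>\<^sup>+ (x, y). c \<omega> x y \<partial>\<pi> \<omega>) = v \<omega>" if "\<omega> \<in> space M" for \<omega>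
  proof (rule antisym)
    show "v \<omega> \<le> (\<integral>\<^sup>+ (x, y). c \<omega> x y \<partial>\<pi> \<omega>)"
      unfolding v_def C_deter_def by (rule INF_lower[OF \<pi>[OF that]])
  qed (rule \<pi>_le[OF that])
  ultimately show "\<exists>\<pi>\<in>kernel_couplings M \<mu> \<nu>. \<forall>\<omega>\<in>space M.
      (\<integral>\<^sup>+ (x, y). c \<omega> x y \<partial>\<pi> \<omega>) = C_deter (c \<omega>) (\<mu> \<omega>) (\<nu> \<omega>)"
    unfolding v_def by blast
qed

lemma kernel_coupling_imp_coupling:
  assumes "\<pi> \<in> kernel_couplings M \<mu> \<nu>" "\<omega> \<in> space M"
  shows "\<pi> \<omega> \<in> couplings (\<mu> \<omega>) (\<nu> \<omega>)"
  using assms by (auto simp: kernel_couplings_def couplings_def prob_kernel_iff)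

theorem theorem1p1:
  fixes M :: "'w measure"
    and \<mu> :: "'w \<Rightarrow> 'a::polish_space measure"
    and \<nu> :: "'w \<Rightarrow> 'b::polish_space measure"
    and c :: "'w \<Rightarrow> 'a \<Rightarrow> 'b \<Rightarrow> ennreal"
  assumes "prob_space M"
    and "prob_kernel M \<mu>"
    and "prob_kernel M \<nu>"
    and "(\<lambda>(\<omega>, x, y). c \<omega> x y) \<in> borel_measurable (M \<Otimes>\<^sub>M (borel \<Otimes>\<^sub>M borel))"
    and "\<And>\<omega>. \<omega> \<in> space M \<Longrightarrow> continuous_on UNIV (\<lambda>(x, y). c \<omega> x y)"
    and "\<And>x y. (\<lambda>\<omega>. c \<omega> x y) \<in> borel_measurable M"
    and "(\<integral>\<^sup>+ \<omega>. (\<integral>\<^sup>+ (x, y). c \<omega> x y \<partial>(\<mu> \<omega> \<Otimes>\<^sub>M \<nu> \<omega>)) \<partial>M) < \<infinity>"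
  shows "(\<exists>\<pi>\<in>kernel_couplings M \<mu> \<nu>.
            C_stoch M c \<mu> \<nu> = (\<integral>\<^sup>+ \<omega>. (\<integral>\<^sup>+ (x, y). c \<omega> x y \<partial>\<pi> \<omega>) \<partial>M) \<and>
            (\<integral>\<^sup>+ \<omega>. (\<integral>\<^sup>+ (x, y). c \<omega> x y \<partial>\<pi> \<omega>) \<partial>M) < \<infinity>) \<and>
         (\<lambda>\<omega>. C_deter (c \<omega>) (\<mu> \<omega>) (\<nu> \<omega>)) \<in> borel_measurable M \<and>
         C_stoch M c \<mu> \<nu> =
           (\<integral>\<^sup>+ \<omega>. (INF \<pi>\<in>couplings (\<mu> \<omega>) (\<nu> \<omega>). \<integral>\<^sup>+ (x, y). c \<omega> x y \<partial>\<pi>) \<partial>M) \<and>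
         C_stoch M c \<mu> \<nu> = (\<integral>\<^sup>+ \<omega>. C_deter (c \<omega>) (\<mu> \<omega>) (\<nu> \<omega>) \<partial>M)"
proof -
  let ?I = "\<lambda>\<pi>. \<integral>\<^sup>+ \<omega>. (\<integral>\<^sup>+ (x, y). c \<omega> x y \<partial>\<pi> \<omega>) \<partial>M"
  let ?V = "\<integral>\<^sup>+ \<omega>. C_deter (c \<omega>) (\<mu> \<omega>) (\<nu> \<omega>) \<partial>M"
  have V_meas: "(\<lambda>\<omega>. C_deter (c \<omega>) (\<mu> \<omega>) (\<nu> \<omega>)) \<in> borel_measurable M"
    by (rule measurable_optimal_kernel(1)) (fact assms)+
  have "\<exists>\<pi>\<in>kernel_couplings M \<mu> \<nu>. \<forall>\<omega>\<in>space M.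
      (\<integral>\<^sup>+ (x, y). c \<omega> x y \<partial>\<pi> \<omega>) = C_deter (c \<omega>) (\<mu> \<omega>) (\<nu> \<omega>)"
    by (rule measurable_optimal_kernel(2)) (fact assms)+
  then obtain \<pi> where \<pi>: "\<pi> \<in> kernel_couplings M \<mu> \<nu>"
    "\<And>\<omega>. \<omega> \<in> space M \<Longrightarrow> (\<integral>\<^sup>+ (x, y). c \<omega> x y \<partial>\<pi> \<omega>) = C_deter (c \<omega>) (\<mu> \<omega>) (\<nu> \<omega>)"
    by blast
  have I_\<pi>: "?I \<pi> = ?V" by (rule nn_integral_cong) (rule \<pi>(2))
  have stoch: "C_stoch M c \<mu> \<nu> = ?V"
    unfolding C_stoch_def
  proof (rule antisym)
    show "(INF \<pi>\<in>kernel_couplings M \<mu> \<nu>. ?I \<pi>) \<le> ?V"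
      unfolding I_\<pi>[symmetric] by (rule INF_lower[OF \<pi>(1)])
    show "?V \<le> (INF \<pi>\<in>kernel_couplings M \<mu> \<nu>. ?I \<pi>)"
    proof (intro INF_greatest nn_integral_mono)
      fix \<rho> \<omega> assume "\<rho> \<in> kernel_couplings M \<mu> \<nu>" "\<omega> \<in> space M"
      then show "C_deter (c \<omega>) (\<mu> \<omega>) (\<nu> \<omega>) \<le> (\<integral>\<^sup>+ (x, y). c \<omega> x y \<partial>\<rho> \<omega>)"
        unfolding C_deter_def by (intro INF_lower kernel_coupling_imp_coupling)
    qed
  qed
  have "?V \<le> (\<integral>\<^sup>+ \<omega>. (\<integral>\<^sup>+ (x, y). c \<omega> x y \<partial>(\<mu> \<omega> \<Otimes>\<^sub>M \<nu> \<omega>)) \<partial>M)"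
  proof (rule nn_integral_mono)
    fix \<omega> assume "\<omega> \<in> space M"
    then have "\<mu> \<omega> \<Otimes>\<^sub>M \<nu> \<omega> \<in> couplings (\<mu> \<omega>) (\<nu> \<omega>)"
      using assms(2,3) by (intro pair_measure_coupling) (auto simp: prob_kernel_iff)
    then show "C_deter (c \<omega>) (\<mu> \<omega>) (\<nu> \<omega>) \<le> (\<integral>\<^sup>+ (x, y). c \<omega> x y \<partial>(\<mu> \<omega> \<Otimes>\<^sub>M \<nu> \<omega>))"
      unfolding C_deter_def by (rule INF_lower)
  qed
  with assms(7) have finite: "?V < \<infinity>" by (rule le_less_trans[rotated])
  show ?thesis
  proof (intro conjI bexI[OF _ \<pi>(1)])
    show "C_stoch M c \<mu> \<nu> = ?I \<pi>" "?I \<pi> < \<infinity>" using stoch finite I_\<pi> by simp_all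
    show "C_stoch M c \<mu> \<nu> =
        (\<integral>\<^sup>+ \<omega>. (INF \<pi>\<in>couplings (\<mu> \<omega>) (\<nu> \<omega>). \<integral>\<^sup>+ (x, y). c \<omega> x y \<partial>\<pi>) \<partial>M)"
      using stoch by (simp add: C_deter_def)
  qed (fact V_meas stoch)+
qed

end
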